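(* Let $\mathsf N^k$ be a partial nightrider with $k$ basic moves ($1\le k\le4$). For each $i\ge0$, the coefficient $q!\gamma_i$ of $n^{2q-i}$ in $o_{\mathsf N^k}(q;n)$ is a polynomial in $q$ (whose coefficients are periodic functions of $n$) with leading term $$\Big(-\frac{5k}{24}\Big)^i\frac{q^{2i}}{i!}.$$
   Context: A partial nightrider $\mathsf N^k$ is a rider whose basic moves are any $k$ of the four vectors $(1,2),(2,1),(1,-2),(2,-1)$. On the $n\times n$ board $[n]^2$, two pieces at positions $z,z'$ attack each other if $z'-z$ is an integer multiple of a basic move (including $z=z'$). $u_{\mathsf P}(q;n)$ is the number of placements of $q$ unlabelled pieces on $[n]^2$ with no two attacking, and $o_{\mathsf P}(q;n)=q!\,u_{\mathsf P}(q;n)$ is the labelled count. $u_{\mathsf P}(q;n)$ is a quasipolynomial in $n$ of degree $2q$, written $u_{\mathsf P}(q;n)=\sum_{i=0}^{2q}\gamma_i(n)n^{2q-i}$ with $\gamma_i(n)$ periodic in $n$. *)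

theory Defs
  imports Complex_Main
begin

text \<open>Basic moves of the full nightrider; a partial nightrider uses a subset of them.\<close>
definition nightrider_moves :: "(int \<times> int) set" where
  "nightrider_moves = {(1,2), (2,1), (1,-2), (2,-1)}"

text \<open>Two positions attack each other if their difference is an integer multiple
  of a basic move (including equal positions).\<close>
definition attacks :: "(int \<times> int) set \<Rightarrow> int \<times> int \<Rightarrow> int \<times> int \<Rightarrow> bool" where
  "attacks M z z' \<longleftrightarrow> (\<exists>t::int. \<exists>m\<in>M.
      fst z' - fst z = t * fst m \<and> snd z' - snd z = t * snd m)"

definition board :: "nat \<Rightarrow> (int \<times> int) set" where
  "board n = {1..int n} \<times> {1..int n}"

text \<open>Unlabelled count: placements of q pieces, no two attacking
  (pieces on a common square attack, so placements are q-subsets).\<close>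
definition u_count :: "(int \<times> int) set \<Rightarrow> nat \<Rightarrow> nat \<Rightarrow> nat" where
  "u_count M q n = card {S. S \<subseteq> board n \<and> card S = q \<and>
      (\<forall>z\<in>S. \<forall>z'\<in>S. z \<noteq> z' \<longrightarrow> \<not> attacks M z z')}"

definition o_count :: "(int \<times> int) set \<Rightarrow> nat \<Rightarrow> nat \<Rightarrow> nat" where
  "o_count M q n = fact q * u_count M q n"

definition periodic_nat :: "(nat \<Rightarrow> real) \<Rightarrow> bool" where
  "periodic_nat f \<longleftrightarrow> (\<exists>p>0. \<forall>n. f (n + p) = f n)"

end

theory Submission
  imports Defs "HOL-Computational_Algebra.Polynomial" "HOL-Library.Landau_Symbols"
    "HOL-Combinatorics.Multiset_Permutations"
begin

text \<open>
  Expanding the labelled count over the squares of the pieces gives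
  \<open>o(q;n) = (\<Sum>l\<le>q. (q choose l) * n^(2(q-l)) * w l n)\<close>, where \<open>w l n\<close> sums, over all \<open>l\<close>-tuples of
  squares, the Moebius inverse of the non-attacking indicator. Each \<open>w l\<close> is a quasipolynomial:
  a lattice-point count is obtained by summing out one coordinate after another, and piecewise
  quasipolynomials with homogeneous walls are closed under this operation.

  The Moebius function vanishes on tuples with an isolated piece, so only configurations in which every
  connected component has at least two pieces contribute to \<open>w l\<close>, whose degree is therefore at most
  \<open>l + l div 2\<close>. Hence only \<open>l \<le> 2i\<close> contributes to the coefficient of \<open>n^(2q-i)\<close>, which makes it a
  polynomial in \<open>q\<close>. Its leading term comes from \<open>l = 2i\<close>, where the perfect matchings dominate; each edge
  of a matching contributes minus the number of attacking pairs, which is asymptotic to \<open>5k/12 * n^3\<close>.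
\<close>

section \<open>Piecewise quasipolynomials\<close>

text \<open>The formula must hold for every \<open>n\<close>, with no exceptional small boards.
  Therefore the side of the board is written as \<open>0 < y < x 0\<close> with
  \<open>x 0 = n + 1\<close>: range bounds and attack conditions become homogeneous linear walls,
  and summing out a coordinate creates no others, since all rounding is absorbed by floors, which
  are quasipolynomial.

  Exact counting and asymptotics are kept apart. The first yields periodic coefficients without
  information about them; the second uses only crude bounds and one limit. A limit over all
  \<open>n\<close> forces the same top coefficient in every residue class, which is why the leading
  term in \<open>q\<close> does not depend on \<open>n\<close>.

  On \<open>2 * i\<close> pieces there are (2i-1)!! perfect matchings, while
  \<open>q choose (2 * i)\<close> has leading term q^(2i)/(2i)!. Their product turns the edge weight
  -5k/12 into -5k/24. Only \<open>k\<close> enters because all four moves align equally many pairs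
  of squares, and lines of different moves through a square share nothing else.\<close>

definition linform :: "nat \<Rightarrow> (nat \<Rightarrow> int) \<Rightarrow> (nat \<Rightarrow> int) \<Rightarrow> int" where
  "linform d c x = (\<Sum>i<d. c i * x i)"

text \<open>Piecewise quasipolynomials in the coordinates \<open>x 0, ..., x (d - 1)\<close>. The walls are homogeneous, so that
  in the single coordinate \<open>x 0 > 0\<close> no case distinction is left.\<close>
inductive_set pqp :: "nat \<Rightarrow> ((nat \<Rightarrow> int) \<Rightarrow> real) set" for d where
  const: "(\<lambda>x. r) \<in> pqp d"
| coord: "i < d \<Longrightarrow> (\<lambda>x. of_int (x i)) \<in> pqp d"
| periodic: "i < d \<Longrightarrow> 0 < m \<Longrightarrow> (\<lambda>x. g (x i mod m)) \<in> pqp d"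
| pos: "(\<lambda>x. of_bool (0 < linform d c x)) \<in> pqp d"
| add: "f \<in> pqp d \<Longrightarrow> g \<in> pqp d \<Longrightarrow> (\<lambda>x. f x + g x) \<in> pqp d"
| mult: "f \<in> pqp d \<Longrightarrow> g \<in> pqp d \<Longrightarrow> (\<lambda>x. f x * g x) \<in> pqp d"

lemma linform_update: "linform d c (x(d := y)) = linform d c x"
  by (simp add: linform_def)

lemma linform_Suc: "linform (Suc d) c x = linform d c x + c d * x d"
  by (simp add: linform_def)

lemma linform_diff: "linform d c x - linform d c' x = linform d (\<lambda>i. c i - c' i) x"
  by (simp add: linform_def sum_subtractf algebra_simps)

lemma linform_uminus: "- linform d c x = linform d (\<lambda>i. - c i) x"
  by (simp add: linform_def sum_negf)

lemma linform_scale: "a * linform d c x = linform d (\<lambda>i. a * c i) x"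
  by (simp add: linform_def sum_distrib_left algebra_simps)

lemma linform_coord: "i < d \<Longrightarrow> linform d (\<lambda>j. if j = i then a else 0) x = a * x i"
  by (simp add: linform_def if_distrib[of "\<lambda>u. u * _"] cong: if_cong)

lemma linform_zero: "linform d (\<lambda>j. 0) x = 0"
  by (simp add: linform_def)

lemma pqp_update: "f \<in> pqp d \<Longrightarrow> f (x(d := y)) = f x"
  by (induction rule: pqp.induct) (simp_all add: linform_def)

lemma pqp_diff: "f \<in> pqp d \<Longrightarrow> g \<in> pqp d \<Longrightarrow> (\<lambda>x. f x - g x) \<in> pqp d"
  using pqp.add[OF _ pqp.mult[OF pqp.const[of "-1"]], of f d g] by simp

lemma pqp_sum: "(\<And>a. a \<in> A \<Longrightarrow> f a \<in> pqp d) \<Longrightarrow> (\<lambda>x. \<Sum>a\<in>A. f a x) \<in> pqp d"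
  by (induction A rule: infinite_finite_induct) (simp_all add: pqp.const pqp.add pqp.mult)

lemma pqp_prod: "(\<And>a. a \<in> A \<Longrightarrow> f a \<in> pqp d) \<Longrightarrow> (\<lambda>x. \<Prod>a\<in>A. f a x) \<in> pqp d"
  by (induction A rule: infinite_finite_induct) (simp_all add: pqp.const pqp.add pqp.mult)

lemma pqp_power: "f \<in> pqp d \<Longrightarrow> (\<lambda>x. f x ^ e) \<in> pqp d"
  by (induction e) (simp_all add: pqp.const pqp.add pqp.mult)

lemma pqp_poly: "f \<in> pqp d \<Longrightarrow> (\<lambda>x. poly p (f x)) \<in> pqp d"
  unfolding poly_altdef by (intro pqp_sum pqp.mult pqp.const pqp_power)

section \<open>Residues and floors of linear forms\<close>

lemma pqp_linform: "(\<lambda>x. of_int (linform d c x)) \<in> pqp d"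
proof -
  have "(\<lambda>x. \<Sum>i<d. of_int (c i) * of_int (x i)) \<in> pqp d"
    by (intro pqp_sum pqp.mult pqp.const pqp.coord) auto
  then show ?thesis by (simp add: linform_def)
qed

text \<open>The generators offer periodic functions of single coordinates only. Casing on the
  residue \<open>r\<close> of the last coordinate turns its contribution into a constant shift
  \<open>c k * r\<close>, which the arbitrary \<open>g\<close> absorbs; the separate prefix length
  \<open>k\<close> makes this an induction inside a fixed \<open>d\<close>.\<close>

lemma pqp_sum_linform_mod:
  assumes m: "0 < m" and "k \<le> d"
  shows "(\<lambda>x. g ((\<Sum>i<k. c i * x i) mod m)) \<in> pqp d"
  using assms(2)
proof (induction k arbitrary: g)
  case 0
  show ?case by (simp add: pqp.const)
next
  case (Suc k)
  define h where "h r x = g (((\<Sum>i<k. c i * x i) mod m + c k * r) mod m)" for r x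
  have "(\<lambda>x. \<Sum>r\<in>{0..<m}. of_bool (x k mod m = r) * h r x) \<in> pqp d"
  proof (intro pqp_sum pqp.mult)
    fix r
    show "(\<lambda>x. of_bool (x k mod m = r)) \<in> pqp d"
      using Suc.prems m by (intro pqp.periodic[where g = "\<lambda>u. of_bool (u = r)"]) auto
    show "h r \<in> pqp d"
      unfolding h_def using Suc.prems by (intro Suc.IH[where g = "\<lambda>u. g ((u + c k * r) mod m)"]) auto
  qed
  moreover have "(\<Sum>r\<in>{0..<m}. of_bool (x k mod m = r) * h r x) = g ((\<Sum>i<Suc k. c i * x i) mod m)" for x
  proof -
    have "(\<Sum>r\<in>{0..<m}. of_bool (x k mod m = r) * h r x) = (\<Sum>r\<in>{x k mod m}. h r x)"
      using m by (intro sum.mono_neutral_cong_right) auto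
    moreover have "((\<Sum>i<k. c i * x i) mod m + c k * (x k mod m)) mod m = (\<Sum>i<Suc k. c i * x i) mod m"
      unfolding sum.lessThan_Suc by (rule mod_add_cong[OF mod_mod_trivial mod_mult_right_eq])
    ultimately show ?thesis by (simp only: h_def sum.insert sum.empty finite.emptyI empty_iff not_False_eq_True add_0_right)
  qed
  ultimately show ?case by (simp only:)
qed

lemma pqp_linform_mod: "0 < m \<Longrightarrow> (\<lambda>x. g (linform d c x mod m)) \<in> pqp d"
  unfolding linform_def by (rule pqp_sum_linform_mod) auto

text \<open>A floor is the exact quotient minus a periodic correction:
  \<open>u div m = (u - u mod m) / m\<close>.\<close>

lemma pqp_linform_div:
  assumes "0 < m"
  shows "(\<lambda>x. of_int ((linform d c x + b) div m)) \<in> pqp d"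
proof -
  have "(\<lambda>x. 1 / of_int m * (of_int (linform d c x) + of_int b - of_int ((linform d c x mod m + b) mod m))) \<in> pqp d"
    by (intro pqp.mult pqp.const pqp_diff pqp.add pqp_linform
        pqp_linform_mod[OF assms, where g = "\<lambda>u. of_int ((u + b) mod m)"])
  moreover have "1 / of_int m * (of_int (linform d c x) + of_int b - of_int ((linform d c x mod m + b) mod m))
      = (of_int ((linform d c x + b) div m) :: real)" for x
  proof -
    let ?u = "linform d c x + b"
    have "of_int ?u = (of_int (m * (?u div m) + ?u mod m) :: real)"
      by (simp only: mult_div_mod_eq)
    then have "of_int (linform d c x) + of_int b - of_int (?u mod m) = (of_int m * of_int (?u div m) :: real)"
      unfolding of_int_add of_int_mult by linarith
    then show ?thesis using assms by (simp add: mod_add_left_eq)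
  qed
  ultimately show ?thesis by simp
qed

lemma pqp_nonneg: "(\<lambda>x. of_bool (0 \<le> linform d c x)) \<in> pqp d"
proof -
  have "(\<lambda>x. 1 - of_bool (0 < linform d (\<lambda>i. - c i) x)) \<in> pqp d"
    by (intro pqp_diff pqp.const pqp.pos)
  moreover have "1 - of_bool (0 < linform d (\<lambda>i. - c i) x) = (of_bool (0 \<le> linform d c x) :: real)" for x
    unfolding linform_uminus[symmetric] by auto
  ultimately show ?thesis by simp
qed

section \<open>Sums of powers and of quasi-monomials\<close>

lemma power_sums_poly: "\<exists>S::real poly. \<forall>n. (\<Sum>k<n. real k ^ e) = poly S (real n)"
proof (induction e rule: less_induct)
  case (less e)
  then obtain T :: "nat \<Rightarrow> real poly"
    where T: "\<And>j n. j < e \<Longrightarrow> (\<Sum>k<n. real k ^ j) = poly (T j) (real n)"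
    by metis
  \<comment> \<open>Telescoping \<open>(k + 1) ^ Suc e - k ^ Suc e\<close> and expanding binomially
    gives a linear relation among the power sums; \<open>S\<close> is its solution for exponent
    \<open>e\<close>.\<close>
  define S where "S = smult (1 / real (Suc e)) (monom 1 (Suc e) - (\<Sum>j<e. smult (real (Suc e choose j)) (T j)))"
  have "(\<Sum>k<n. real k ^ e) = poly S (real n)" for n
  proof -
    have "real n ^ Suc e = (\<Sum>k<n. real (Suc k) ^ Suc e - real k ^ Suc e)"
      by (subst sum_lessThan_telescope) simp
    also have "\<dots> = (\<Sum>k<n. \<Sum>j\<le>e. real (Suc e choose j) * real k ^ j)"
    proof (rule sum.cong[OF refl])
      fix k
      have "real (Suc k) ^ Suc e = (\<Sum>j\<le>Suc e. real (Suc e choose j) * real k ^ j)"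
        using binomial_ring[of "real k" 1 "Suc e"] by (simp add: add.commute)
      then show "real (Suc k) ^ Suc e - real k ^ Suc e = (\<Sum>j\<le>e. real (Suc e choose j) * real k ^ j)"
        by simp
    qed
    also have "\<dots> = (\<Sum>j\<le>e. real (Suc e choose j) * (\<Sum>k<n. real k ^ j))"
      by (subst sum.swap) (simp add: sum_distrib_left)
    also have "\<dots> = (\<Sum>j<e. real (Suc e choose j) * poly (T j) (real n)) + real (Suc e) * (\<Sum>k<n. real k ^ e)"
      by (simp add: T lessThan_Suc_atMost[symmetric] del: binomial_Suc_Suc)
    finally show ?thesis
      by (simp add: S_def poly_sum poly_monom field_simps del: binomial_Suc_Suc)
  qed
  then show ?case by blast
qed

lemma poly_sums_poly: "\<exists>S::real poly. \<forall>n. (\<Sum>k<n. poly p (real k)) = poly S (real n)"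
proof -
  obtain T :: "nat \<Rightarrow> real poly" where T: "\<And>e n. (\<Sum>k<n. real k ^ e) = poly (T e) (real n)"
    using power_sums_poly by metis
  have "(\<Sum>k<n. poly p (real k)) = poly (\<Sum>e\<le>degree p. smult (coeff p e) (T e)) (real n)" for n
    unfolding poly_altdef[of p]
    by (subst sum.swap) (simp add: poly_sum sum_distrib_left[symmetric] T)
  then show ?thesis by blast
qed

text \<open>On \<open>y = m * k + r\<close> the periodic factor is constant. Residues are
  represented in \<open>{1..m}\<close> so that \<open>0 < y\<close> reads \<open>0 \<le> k\<close>,
  and \<open>y \<le> z\<close> reads \<open>k < (z - r + m) div m\<close>. Thus \<open>z\<close>
  enters only through floors, which are harmless when \<open>z\<close> is itself the floor of a
  linear form.\<close>

lemma quasi_monomial_sum: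
  fixes g :: "int \<Rightarrow> real"
  assumes m: "0 < m"
  shows "\<exists>S :: int \<Rightarrow> real poly. \<forall>z\<ge>0. (\<Sum>y\<in>{0<..z}. of_int y ^ e * g (y mod m))
        = (\<Sum>r\<in>{1..m}. g (r mod m) * poly (S r) (of_int ((z - r + m) div m)))"
proof -
  have "\<exists>S::real poly. \<forall>n. (\<Sum>k<n. (of_int m * real k + of_int r) ^ e) = poly S (real n)" for r :: int
  proof -
    have "(of_int m * real k + of_int r) ^ e = poly ([:of_int r, of_int m:] ^ e) (real k)" for k
      by (simp add: algebra_simps)
    then show ?thesis
      using poly_sums_poly[of "[:of_int r, of_int m:] ^ e"] by (simp only:)
  qed
  then obtain S :: "int \<Rightarrow> real poly"
    where S: "\<And>r n. (\<Sum>k<n. (of_int m * real k + of_int r) ^ e) = poly (S r) (real n)"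
    by metis
  show ?thesis
  proof (intro exI[of _ S] allI impI)
    fix z :: int assume z: "0 \<le> z"
    have "(\<Sum>y\<in>{0<..z}. of_int y ^ e * g (y mod m))
      = (\<Sum>(r,k)\<in>(SIGMA r:{1..m}. {..<nat ((z - r + m) div m)}). of_int (m * int k + r) ^ e * g (r mod m))"
    proof (rule sum.reindex_bij_witness[where i = "\<lambda>(r,k). m * int k + r" and j = "\<lambda>y. ((y - 1) mod m + 1, nat ((y - 1) div m))"])
      fix y assume y: "y \<in> {0<..z}"
      have nn: "0 \<le> (y - 1) div m" using y m by (simp add: pos_imp_zdiv_nonneg_iff)
      have dec: "m * ((y - 1) div m) + ((y - 1) mod m + 1) = y"
        using mult_div_mod_eq[of m "y - 1"] by linarith
      have bd: "0 \<le> (y - 1) mod m" "(y - 1) mod m < m" using m by simp_all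
      show "(case ((y - 1) mod m + 1, nat ((y - 1) div m)) of (r, k) \<Rightarrow> m * int k + r) = y"
        using nn dec by simp
      have "((y - 1) div m + 1) * m \<le> z - ((y - 1) mod m + 1) + m"
        using dec y by (simp add: algebra_simps)
      then have "(y - 1) div m + 1 \<le> (z - ((y - 1) mod m + 1) + m) div m"
        by (metis zdiv_mono1 m nonzero_mult_div_cancel_right less_irrefl)
      then show "((y - 1) mod m + 1, nat ((y - 1) div m)) \<in> (SIGMA r:{1..m}. {..<nat ((z - r + m) div m)})"
        using bd nn by auto
      have "((y - 1) mod m + 1) mod m = y mod m" by (simp add: mod_simps)
      then show "(case ((y - 1) mod m + 1, nat ((y - 1) div m)) of (r, k) \<Rightarrow> of_int (m * int k + r) ^ e * g (r mod m)) = of_int y ^ e * g (y mod m)"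
        using nn by (simp only: split int_nat_eq if_True dec)
    next
      fix rk assume "rk \<in> (SIGMA r:{1..m}. {..<nat ((z - r + m) div m)})"
      then obtain r k where rk: "rk = (r, k)" "1 \<le> r" "r \<le> m" "int k < (z - r + m) div m"
        by auto
      have eq: "m * int k + r - 1 = (r - 1) + int k * m" by simp
      have d: "(m * int k + r - 1) div m = int k" "(m * int k + r - 1) mod m = r - 1"
        unfolding eq using rk m by auto
      show "(\<lambda>y. ((y - 1) mod m + 1, nat ((y - 1) div m))) (case rk of (r, k) \<Rightarrow> m * int k + r) = rk"
        using d rk by simp
      have "(int k + 1) * m \<le> z - r + m"
      proof -
        have "(int k + 1) * m \<le> ((z - r + m) div m) * m" using rk m by (intro mult_right_mono) auto
        also have "\<dots> \<le> z - r + m"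
          using m by (simp only: minus_mod_eq_div_mult[symmetric]) simp
        finally show ?thesis .
      qed
      moreover have "0 < m * int k + r" using m rk by (intro add_nonneg_pos) auto
      ultimately show "(case rk of (r, k) \<Rightarrow> m * int k + r) \<in> {0<..z}"
        using rk by (simp add: algebra_simps)
    qed
    also have "\<dots> = (\<Sum>r\<in>{1..m}. g (r mod m) * (\<Sum>k<nat ((z - r + m) div m). (of_int m * real k + of_int r) ^ e))"
      by (subst sum.Sigma[symmetric]) (auto simp: sum_distrib_left mult.commute)
    also have "\<dots> = (\<Sum>r\<in>{1..m}. g (r mod m) * poly (S r) (of_int ((z - r + m) div m)))"
    proof (rule sum.cong[OF refl])
      fix r assume "r \<in> {1..m}"
      then have "0 \<le> (z - r + m) div m" using z m by (subst pos_imp_zdiv_nonneg_iff) auto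
      then show "g (r mod m) * (\<Sum>k<nat ((z - r + m) div m). (of_int m * real k + of_int r) ^ e)
         = g (r mod m) * poly (S r) (of_int ((z - r + m) div m))"
        by (simp add: S)
    qed
    finally show "(\<Sum>y\<in>{0<..z}. of_int y ^ e * g (y mod m))
        = (\<Sum>r\<in>{1..m}. g (r mod m) * poly (S r) (of_int ((z - r + m) div m)))" .
  qed
qed

text \<open>Normal form in the last coordinate: only one lower threshold per summand, strict for \<open>s = 0\<close> and weak
  for \<open>s = 1\<close>. An upper threshold is one minus a lower one, and a product of two lower thresholds is the
  larger one, which is selected by a homogeneous wall in the other coordinates.\<close>
inductive_set nf :: "nat \<Rightarrow> ((nat \<Rightarrow> int) \<Rightarrow> real) set" for d where
  "term": "h \<in> pqp d \<Longrightarrow> 0 < a \<Longrightarrow> s \<in> {0, 1} \<Longrightarrow> 0 < m \<Longrightarrow>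
    (\<lambda>x. h x * of_bool (linform d c x - s < a * x d) * of_int (x d) ^ e * g (x d mod m)) \<in> nf d"
| add: "f \<in> nf d \<Longrightarrow> g \<in> nf d \<Longrightarrow> (\<lambda>x. f x + g x) \<in> nf d"

text \<open>Over the integers, \<open>L - s < a * y\<close> means that \<open>y\<close> is above
  \<open>L / a\<close>, strictly for \<open>s = 0\<close> and weakly for \<open>s = 1\<close>. Two
  thresholds are therefore compared by the sign of \<open>a' * L - a * L'\<close> with ties decided
  by \<open>s\<close>, and the shift never enters a wall.\<close>

lemma threshold_le:
  fixes a a' L L' s s' y :: int
  assumes "0 < a" "0 < a'" "s \<in> {0, 1}" "s' \<in> {0, 1}"
    and "a * L' < a' * L \<or> a * L' \<le> a' * L \<and> s \<le> s'" and "L - s < a * y"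
  shows "L' - s' < a' * y"
proof -
  have "a * (L' - s') < a * (a' * y)"
  proof (cases "s = 0")
    case True
    then have "a' * L < a' * (a * y)" using assms by simp
    moreover have "a * (L' - s') \<le> a * L'" using assms by (auto simp: algebra_simps)
    ultimately show ?thesis using assms(5) unfolding mult.left_commute[of a a' y] by linarith
  next
    case False
    then have s: "s = 1" using assms by simp
    then have "a' * L \<le> a' * (a * y)" using assms by simp
    moreover have "a * (L' - s') < a' * L"
      using assms s by (auto simp: algebra_simps)
    ultimately show ?thesis unfolding mult.left_commute[of a a' y] by linarith
  qed
  then show ?thesis using assms(1) by simp
qed

text \<open>Exactly one selector is true, and it picks the stronger condition; in a tie it prefers
  the smaller shift, that is, the strict one.\<close>

lemma threshold_mult:
  fixes a a' L L' s s' y :: int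
  assumes "0 < a" "0 < a'" "s \<in> {0, 1}" "s' \<in> {0, 1}"
  shows "of_bool (L - s < a * y) * of_bool (L' - s' < a' * y) =
    (of_bool (if s \<le> s' then 0 \<le> a' * L - a * L' else 0 < a' * L - a * L') * of_bool (L - s < a * y)
     + of_bool (if s \<le> s' then 0 < a * L' - a' * L else 0 \<le> a * L' - a' * L) * of_bool (L' - s' < a' * y) :: real)"
proof (cases "s \<le> s'")
  case True
  then show ?thesis
    using threshold_le[OF assms, of L' L y] threshold_le[OF assms(2,1,4,3), of L L' y] by auto
next
  case False
  then have "s' \<le> s" by simp
  with False show ?thesis
    using threshold_le[OF assms, of L' L y] threshold_le[OF assms(2,1,4,3), of L L' y] by auto
qed

lemma nf_mult_term:
  assumes "h \<in> pqp d" "0 < a" "s \<in> {0, 1}" "0 < m" "h' \<in> pqp d" "0 < a'" "s' \<in> {0, 1}" "0 < m'"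
  shows "(\<lambda>x. (h x * of_bool (linform d c x - s < a * x d) * of_int (x d) ^ e * g (x d mod m)) *
      (h' x * of_bool (linform d c' x - s' < a' * x d) * of_int (x d) ^ e' * g' (x d mod m'))) \<in> nf d"
proof -
  \<comment> \<open>A single residue modulo \<open>m * m'\<close> determines both periodic
    factors.\<close>
  define G where "G u = g (u mod m) * g' (u mod m')" for u
  have G: "G (y mod (m * m')) = g (y mod m) * g' (y mod m')" for y
    by (simp add: G_def mod_mod_cancel)
  define u where "u x = linform d (\<lambda>i. a' * c i - a * c' i) x" for x
  have u: "a' * linform d c x - a * linform d c' x = u x" for x
    unfolding u_def by (simp add: linform_scale linform_diff)
  define v where "v x = linform d (\<lambda>i. a * c' i - a' * c i) x" for x
  have v: "a * linform d c' x - a' * linform d c x = v x" for x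
    unfolding v_def by (simp add: linform_scale linform_diff)
  define p where "p x = (of_bool (if s \<le> s' then 0 \<le> u x else 0 < u x) :: real)" for x
  define p' where "p' x = (of_bool (if s \<le> s' then 0 < v x else 0 \<le> v x) :: real)" for x
  have p: "p \<in> pqp d" "p' \<in> pqp d"
    unfolding p_def p'_def u_def v_def by (cases "s \<le> s'"; simp add: pqp.pos pqp_nonneg)+
  have "(\<lambda>x. ((h x * h' x) * p x) * of_bool (linform d c x - s < a * x d) * of_int (x d) ^ (e + e') * G (x d mod (m * m'))
     + ((h x * h' x) * p' x) * of_bool (linform d c' x - s' < a' * x d) * of_int (x d) ^ (e + e') * G (x d mod (m * m'))) \<in> nf d"
    using assms p by (intro nf.add nf.term pqp.mult) auto
  moreover have "(h x * of_bool (linform d c x - s < a * x d) * of_int (x d) ^ e * g (x d mod m)) *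
      (h' x * of_bool (linform d c' x - s' < a' * x d) * of_int (x d) ^ e' * g' (x d mod m'))
     = ((h x * h' x) * p x) * of_bool (linform d c x - s < a * x d) * of_int (x d) ^ (e + e') * G (x d mod (m * m'))
     + ((h x * h' x) * p' x) * of_bool (linform d c' x - s' < a' * x d) * of_int (x d) ^ (e + e') * G (x d mod (m * m'))" (is "?l = ?r") for x
  proof -
    let ?T = "of_bool (linform d c x - s < a * x d) :: real"
    let ?T' = "of_bool (linform d c' x - s' < a' * x d) :: real"
    let ?w = "(h x * h' x) * of_int (x d) ^ (e + e') * G (x d mod (m * m'))"
    have "?l = ?w * (?T * ?T')" unfolding G power_add by (simp only: mult_ac)
    also have "?T * ?T' = p x * ?T + p' x * ?T'"
      using threshold_mult[OF assms(2,6,3,7), of "linform d c x" "x d" "linform d c' x"]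
      unfolding u v p_def p'_def .
    also have "?w * (p x * ?T + p' x * ?T') = ?r" by (simp only: distrib_left mult_ac)
    finally show ?thesis .
  qed
  ultimately show ?thesis by (simp only:)
qed

lemma nf_mult:
  assumes "f \<in> nf d" "f' \<in> nf d"
  shows "(\<lambda>x. f x * f' x) \<in> nf d"
  using assms(1)
proof induction
  case ("term" h a s m c e g)
  note t = this
  from assms(2) show ?case
  proof induction
    case ("term" h' a' s' m' c' e' g')
    then show ?case using t by (intro nf_mult_term)
  next
    case (add f1 f2)
    then show ?case using nf.add[OF add.IH] by (simp only: distrib_left)
  qed
next
  case (add f1 f2)
  then show ?case using nf.add[OF add.IH] by (simp only: distrib_right)
qed

text \<open>Summands without a threshold receive the vacuous \<open>0 < x d\<close>. Agreement for
  positive \<open>x d\<close> is enough, since coordinates are summed over positive values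
  only.\<close>

lemma nf_lift:
  assumes "h \<in> pqp d" "0 < m"
  shows "\<exists>k\<in>nf d. \<forall>x. 0 < x d \<longrightarrow> h x * of_int (x d) ^ e * g (x d mod m) = k x"
proof
  show "(\<lambda>x. h x * of_bool (linform d (\<lambda>_. 0) x - 0 < 1 * x d) * of_int (x d) ^ e * g (x d mod m)) \<in> nf d"
    using assms by (intro nf.term) auto
qed (simp add: linform_zero)

section \<open>Reduction to normal form and elimination of a coordinate\<close>

lemma pqp_normal_form:
  assumes "f \<in> pqp (Suc d)"
  shows "\<exists>g\<in>nf d. \<forall>x. 0 < x d \<longrightarrow> f x = g x"
  using assms
proof induction
  case (const r)
  show ?case using nf_lift[OF pqp.const[of r], of 1 d 0 "\<lambda>_. 1"] by simp
next
  case (coord i)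
  show ?case
  proof (cases "i = d")
    case True
    then show ?thesis using nf_lift[OF pqp.const[of 1], of 1 d 1 "\<lambda>_. 1"] by simp
  next
    case False
    then show ?thesis using nf_lift[OF pqp.coord, of i d 1 0 "\<lambda>_. 1"] coord by simp
  qed
next
  case (periodic i m g)
  show ?case
  proof (cases "i = d")
    case True
    then show ?thesis using nf_lift[OF pqp.const[of 1] periodic(2), of d 0 g] by simp
  next
    case False
    then have "i < d" using periodic by simp
    then show ?thesis using nf_lift[OF pqp.periodic[OF _ periodic(2), of i d g], of 1 0 "\<lambda>_. 1"] by simp
  qed
next
  case (pos c)
  consider "c d = 0" | "0 < c d" | "c d < 0" by linarith
  then show ?case
  proof cases
    case 1
    then show ?thesis
      using nf_lift[OF pqp.pos, of 1 d c 0 "\<lambda>_. 1"] by (simp add: linform_Suc)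
  next
    case 2
    have "(\<lambda>x. 1 * of_bool (linform d (\<lambda>i. - c i) x - 0 < c d * x d) * of_int (x d) ^ 0 * 1) \<in> nf d"
      using 2 by (intro nf.term[where m = 1 and g = "\<lambda>_. 1"] pqp.const) auto
    moreover have "(0 < linform (Suc d) c x) = (linform d (\<lambda>i. - c i) x - 0 < c d * x d)" for x
      unfolding linform_uminus[symmetric] linform_Suc by auto
    ultimately show ?thesis by (intro bexI) auto
  next
    case 3
    obtain k where k: "k \<in> nf d" "\<And>x. 0 < x d \<Longrightarrow> k x = 1"
      using nf_lift[OF pqp.const[of 1], of 1 d 0 "\<lambda>_. 1"] by auto
    \<comment> \<open>The negation of \<open>0 < L + c d * x d\<close> is
      \<open>L \<le> (- c d) * x d\<close>, a weak threshold; this is the source of the shift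
      \<open>s = 1\<close>.\<close>
    have mem: "(\<lambda>x. k x + (- 1) * of_bool (linform d c x - 1 < (- c d) * x d) * of_int (x d) ^ 0 * 1) \<in> nf d"
      using 3 by (intro nf.add k(1) nf.term[where m = 1 and g = "\<lambda>_. 1"] pqp.const) auto
    have "of_bool (0 < linform (Suc d) c x) = (k x + (- 1) * of_bool (linform d c x - 1 < (- c d) * x d) * of_int (x d) ^ 0 * 1 :: real)" if "0 < x d" for x
      using k(2)[of x, OF that] unfolding linform_Suc by auto
    then show ?thesis by (intro bexI[OF _ mem] allI impI)
  qed
next
  case (add f g)
  then obtain f' g' where fg: "f' \<in> nf d" "g' \<in> nf d"
    and "\<And>x. 0 < x d \<Longrightarrow> f x = f' x" "\<And>x. 0 < x d \<Longrightarrow> g x = g' x"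
    by blast
  then show ?case by (intro bexI[OF _ nf.add[OF fg]]) simp
next
  case (mult f g)
  then obtain f' g' where fg: "f' \<in> nf d" "g' \<in> nf d"
    and "\<And>x. 0 < x d \<Longrightarrow> f x = f' x" "\<And>x. 0 < x d \<Longrightarrow> g x = g' x"
    by blast
  then show ?case by (intro bexI[OF _ nf_mult[OF fg]]) simp
qed

text \<open>With \<open>z = (L - s) div a\<close> the threshold is \<open>z < y\<close>. The sum is
  the full one, a difference of two initial sums, or empty, according to whether
  \<open>z < 0\<close>, \<open>0 \<le> z < x 0\<close> or \<open>x 0 \<le> z\<close>, and these
  cases are separated by homogeneous walls.\<close>

lemma pqp_sum_threshold:
  assumes d: "0 < d" and a: "0 < a" and s: "s \<in> {0, 1}" and m: "0 < m"
  shows "\<exists>k\<in>pqp d. \<forall>x. 0 < x 0 \<longrightarrow>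
    (\<Sum>y\<in>{0<..<x 0}. of_bool (linform d c x - s < a * y) * of_int y ^ e * g (y mod m)) = k x"
proof -
  obtain S :: "int \<Rightarrow> real poly" where S:
    "\<And>z. 0 \<le> z \<Longrightarrow> (\<Sum>y\<in>{0<..z}. of_int y ^ e * g (y mod m))
        = (\<Sum>r\<in>{1..m}. g (r mod m) * poly (S r) (of_int ((z - r + m) div m)))"
    using quasi_monomial_sum[OF m, of e g] by blast
  \<comment> \<open>\<open>H\<close> is the closed form of \<open>G\<close>. They agree only for
    \<open>0 \<le> z\<close>; elsewhere \<open>H\<close> may be meaningless, and the indicators
    \<open>A\<close> and \<open>B\<close> cancel it.\<close>
  define G where "G z = (\<Sum>y\<in>{0<..z}. of_int y ^ e * g (y mod m))" for z
  define H where "H z = (\<Sum>r\<in>{1..m}. g (r mod m) * poly (S r) (of_int ((z - r + m) div m)))" for z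
  have GH: "G z = H z" if "0 \<le> z" for z using S[OF that] by (simp add: G_def H_def)
  have H_pqp: "(\<lambda>x. H ((linform d c x + b) div a)) \<in> pqp d" if "0 < a" for a b c
  proof -
    have "(\<lambda>x. \<Sum>r\<in>{1..m}. g (r mod m) * poly (S r) (of_int ((linform d c x + (b + a * (m - r))) div (a * m)))) \<in> pqp d"
      using that m by (intro pqp_sum pqp.mult pqp.const pqp_poly pqp_linform_div) auto
    \<comment> \<open>Nested floors collapse: division by \<open>a\<close> and then by
      \<open>m\<close> is division by \<open>a * m\<close>, so one floor of a linear form
      remains.\<close>
    moreover have "(linform d c x + (b + a * (m - r))) div (a * m) = ((linform d c x + b) div a - r + m) div m" for x r
    proof -
      have "(linform d c x + (b + a * (m - r))) div a = (linform d c x + b + (m - r) * a) div a"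
        by (simp only: mult.commute add.assoc)
      also have "\<dots> = (linform d c x + b) div a - r + m"
        using that by (subst div_mult_self1) auto
      finally show ?thesis using that m by (simp add: div_mult2_eq zdiv_zmult2_eq)
    qed
    ultimately show ?thesis by (simp add: H_def)
  qed
  \<comment> \<open>\<open>A\<close> encodes \<open>z < 0\<close> and \<open>B\<close> encodes
    \<open>0 \<le> z < x 0\<close>. Distinguishing \<open>s = 0\<close> from \<open>s = 1\<close>
    trades the shift for strict or weak homogeneous inequalities.\<close>
  define A where "A x = (if s = 0 then of_bool (linform d c x < 0) else of_bool (linform d c x \<le> 0) :: real)" for x
  define B where "B x = (if s = 0 then of_bool (0 \<le> linform d c x) * of_bool (linform d c x < a * x 0)
      else of_bool (0 < linform d c x) * of_bool (linform d c x \<le> a * x 0) :: real)" for x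
  define c' where "c' i = (if i = 0 then a else 0) - c i" for i
  have c': "linform d c' x = a * x 0 - linform d c x" for x
    unfolding c'_def linform_diff[symmetric] using linform_coord[OF d, of a x] by simp
  define c0 where "c0 i = (if i = 0 then 1 else 0 :: int)" for i :: nat
  have c0: "linform d c0 x = x 0" for x
    unfolding c0_def using linform_coord[OF d, of 1 x] by simp
  have A: "A \<in> pqp d"
    using pqp.pos[of d "\<lambda>i. - c i"] pqp_nonneg[of d "\<lambda>i. - c i"]
    unfolding linform_uminus[symmetric] A_def by (cases "s = 0") simp_all
  have B: "B \<in> pqp d"
    using pqp.mult[OF pqp_nonneg[of d c] pqp.pos[of d c']] pqp.mult[OF pqp.pos[of d c] pqp_nonneg[of d c']]
    unfolding c' B_def by (cases "s = 0") simp_all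
  show ?thesis
  proof (rule bexI, intro allI impI)
    have H0: "(\<lambda>x. H (x 0 - 1)) \<in> pqp d"
      using H_pqp[of 1 c0 "-1"] by (simp add: c0)
    have H1: "(\<lambda>x. H ((linform d c x - s) div a)) \<in> pqp d"
      using H_pqp[of a c "- s"] a by simp
    show "(\<lambda>x. A x * H (x 0 - 1) + B x * (H (x 0 - 1) - H ((linform d c x - s) div a))) \<in> pqp d"
      by (intro pqp.add pqp.mult A B H0 H1 pqp_diff)
  next
    fix x :: "nat \<Rightarrow> int" assume t: "0 < x 0"
    define L where "L = linform d c x"
    define z where "z = (L - s) div a"
    have zy: "L - s < a * y \<longleftrightarrow> z < y" for y
    proof -
      have "(L - s + (- y) * a) div a = z - y"
        unfolding z_def using a by (subst div_mult_self1) auto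
      then show ?thesis
        using pos_imp_zdiv_neg_iff[OF a, of "L - s + (- y) * a"] by (simp add: mult.commute)
    qed
    have sum: "(\<Sum>y\<in>{0<..<x 0}. of_bool (linform d c x - s < a * y) * of_int y ^ e * g (y mod m))
       = (\<Sum>y\<in>{max 0 z<..x 0 - 1}. of_int y ^ e * g (y mod m))"
      by (rule sum.mono_neutral_cong_right) (auto simp: zy L_def[symmetric])
    have diff: "(\<Sum>y\<in>{z<..x 0 - 1}. of_int y ^ e * g (y mod m)) = H (x 0 - 1) - H z"
      if "0 \<le> z" "z \<le> x 0 - 1"
    proof -
      have "{0<..x 0 - 1} = {0<..z} \<union> {z<..x 0 - 1}" using that by auto
      then have "G (x 0 - 1) = G z + (\<Sum>y\<in>{z<..x 0 - 1}. of_int y ^ e * g (y mod m))"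
        unfolding G_def by (simp add: sum.union_disjoint ivl_disj_int)
      then show ?thesis using GH that t by simp
    qed
    have "z < 0 \<longleftrightarrow> L - s < 0" using zy[of 0] by simp
    moreover have "z < x 0 \<longleftrightarrow> L - s < a * x 0" using zy[of "x 0"] by simp
    ultimately consider "z < 0" "A x = 1" "B x = 0" | "0 \<le> z" "z < x 0" "A x = 0" "B x = 1" | "x 0 \<le> z" "A x = 0" "B x = 0"
      using s a t by (fastforce simp: A_def B_def L_def[symmetric] not_less intro: order_less_le_trans split: if_splits)
    then show "(\<Sum>y\<in>{0<..<x 0}. of_bool (linform d c x - s < a * y) * of_int y ^ e * g (y mod m))
      = A x * H (x 0 - 1) + B x * (H (x 0 - 1) - H ((linform d c x - s) div a))"
    proof cases
      case 1
      then show ?thesis unfolding sum using GH[of "x 0 - 1"] t by (simp add: G_def)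
    next
      case 2
      then show ?thesis unfolding sum using diff by (simp add: z_def L_def[symmetric])
    next
      case 3
      then show ?thesis unfolding sum by simp
    qed
  qed
qed

lemma nf_sum:
  assumes "f \<in> nf d" "0 < d"
  shows "\<exists>k\<in>pqp d. \<forall>x. 0 < x 0 \<longrightarrow> (\<Sum>y\<in>{0<..<x 0}. f (x(d := y))) = k x"
  using assms(1)
proof induction
  case ("term" h a s m c e g)
  obtain k where k: "k \<in> pqp d" "\<And>x. 0 < x 0 \<Longrightarrow>
    (\<Sum>y\<in>{0<..<x 0}. of_bool (linform d c x - s < a * y) * of_int y ^ e * g (y mod m)) = k x"
    using pqp_sum_threshold[OF assms(2) "term"(2-4), of c e g] by blast
  show ?case
  proof (rule bexI[OF _ pqp.mult[OF "term"(1) k(1)]], intro allI impI)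
    fix x :: "nat \<Rightarrow> int" assume x: "0 < x 0"
    show "(\<Sum>y\<in>{0<..<x 0}. h (x(d := y)) * of_bool (linform d c (x(d := y)) - s < a * (x(d := y)) d) *
      of_int ((x(d := y)) d) ^ e * g ((x(d := y)) d mod m)) = h x * k x"
      unfolding k(2)[of x, OF x, symmetric] sum_distrib_left pqp_update[OF "term"(1)] linform_update
      by (simp add: mult.assoc)
  qed
next
  case (add f g)
  then obtain f' g' where fg: "f' \<in> pqp d" "g' \<in> pqp d" and
    "\<And>x. 0 < x 0 \<Longrightarrow> (\<Sum>y\<in>{0<..<x 0}. f (x(d := y))) = f' x"
    "\<And>x. 0 < x 0 \<Longrightarrow> (\<Sum>y\<in>{0<..<x 0}. g (x(d := y))) = g' x"
    by blast
  then show ?case by (intro bexI[OF _ pqp.add[OF fg]]) (simp add: sum.distrib del: fun_upd_apply)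
qed

lemma pqp_eliminate:
  assumes "f \<in> pqp (Suc d)" "0 < d"
  shows "\<exists>k\<in>pqp d. \<forall>x. 0 < x 0 \<longrightarrow> (\<Sum>y\<in>{0<..<x 0}. f (x(d := y))) = k x"
proof -
  obtain g where g: "g \<in> nf d" "\<And>x. 0 < x d \<Longrightarrow> f x = g x"
    using pqp_normal_form[OF assms(1)] by blast
  have "(\<Sum>y\<in>{0<..<x 0}. f (x(d := y))) = (\<Sum>y\<in>{0<..<x 0}. g (x(d := y)))" for x
    by (rule sum.cong) (auto simp: g(2))
  then show ?thesis using nf_sum[OF g(1) assms(2)] by simp
qed

text \<open>The bound of every summation is the coordinate \<open>x 0\<close> itself, so the
  dependence on the board size survives as the last remaining variable.\<close>

fun itsum :: "nat \<Rightarrow> nat \<Rightarrow> ((nat \<Rightarrow> int) \<Rightarrow> real) \<Rightarrow> (nat \<Rightarrow> int) \<Rightarrow> real" where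
  "itsum d 0 f x = f x"
| "itsum d (Suc k) f x = (\<Sum>y\<in>{0<..<x 0}. itsum (Suc d) k f (x(d := y)))"

lemma pqp_itsum:
  assumes "f \<in> pqp (d + k)" "0 < d"
  shows "\<exists>g\<in>pqp d. \<forall>x. 0 < x 0 \<longrightarrow> itsum d k f x = g x"
  using assms
proof (induction k arbitrary: d)
  case 0
  then show ?case by auto
next
  case (Suc k)
  obtain g where g: "g \<in> pqp (Suc d)" "\<And>x. 0 < x 0 \<Longrightarrow> itsum (Suc d) k f x = g x"
    using Suc.IH[of "Suc d"] Suc.prems by auto
  have "itsum d (Suc k) f x = (\<Sum>y\<in>{0<..<x 0}. g (x(d := y)))" if "0 < x 0" for x
    using Suc.prems that by (auto simp: g(2) intro!: sum.cong)
  then show ?case using pqp_eliminate[OF g(1) Suc.prems(2)] by simp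
qed

section \<open>Quasipolynomials\<close>

definition quasi_poly :: "(nat \<Rightarrow> real) \<Rightarrow> bool" where
  "quasi_poly f \<longleftrightarrow> (\<exists>p>0. \<exists>P::nat \<Rightarrow> real poly. \<forall>n. f n = poly (P (n mod p)) (real n))"

lemma quasi_poly_polynomial: "quasi_poly (\<lambda>n. poly p (real n))"
  unfolding quasi_poly_def by (intro exI[of _ 1] conjI exI[of _ "\<lambda>_. p"]) auto

lemma quasi_poly_periodic: "0 < p \<Longrightarrow> quasi_poly (\<lambda>n. g (n mod p))"
  unfolding quasi_poly_def by (intro exI[of _ p] conjI exI[of _ "\<lambda>r. [:g r:]"]) auto

lemma quasi_poly_common_period:
  assumes "quasi_poly f" "quasi_poly g"
  shows "\<exists>p P Q. 0 < p \<and> (\<forall>n. f n = poly (P (n mod p)) (real n)) \<and> (\<forall>n. g n = poly (Q (n mod p)) (real n))"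
proof -
  obtain p P where p: "0 < p" "\<And>n. f n = poly (P (n mod p)) (real n)"
    using assms(1) unfolding quasi_poly_def by blast
  obtain q Q where q: "0 < q" "\<And>n. g n = poly (Q (n mod q)) (real n)"
    using assms(2) unfolding quasi_poly_def by blast
  show ?thesis
    by (rule exI[of _ "p * q"], rule exI[of _ "\<lambda>r. P (r mod p)"], rule exI[of _ "\<lambda>r. Q (r mod q)"])
       (simp add: p q mod_mod_cancel)
qed

lemma quasi_poly_add:
  assumes "quasi_poly f" "quasi_poly g"
  shows "quasi_poly (\<lambda>n. f n + g n)"
proof -
  obtain p P Q where "0 < p" "\<And>n. f n = poly (P (n mod p)) (real n)" "\<And>n. g n = poly (Q (n mod p)) (real n)"
    using quasi_poly_common_period[OF assms] by blast
  then show ?thesis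
    unfolding quasi_poly_def by (intro exI[of _ p] conjI exI[of _ "\<lambda>r. P r + Q r"]) simp_all
qed

lemma quasi_poly_mult:
  assumes "quasi_poly f" "quasi_poly g"
  shows "quasi_poly (\<lambda>n. f n * g n)"
proof -
  obtain p P Q where "0 < p" "\<And>n. f n = poly (P (n mod p)) (real n)" "\<And>n. g n = poly (Q (n mod p)) (real n)"
    using quasi_poly_common_period[OF assms] by blast
  then show ?thesis
    unfolding quasi_poly_def by (intro exI[of _ p] conjI exI[of _ "\<lambda>r. P r * Q r"]) simp_all
qed

lemma quasi_poly_diff:
  assumes "quasi_poly f" "quasi_poly g"
  shows "quasi_poly (\<lambda>n. f n - g n)"
proof -
  obtain p P Q where "0 < p" "\<And>n. f n = poly (P (n mod p)) (real n)" "\<And>n. g n = poly (Q (n mod p)) (real n)"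
    using quasi_poly_common_period[OF assms] by blast
  then show ?thesis
    unfolding quasi_poly_def by (intro exI[of _ p] conjI exI[of _ "\<lambda>r. P r - Q r"]) simp_all
qed

lemma quasi_poly_sum: "(\<And>a. a \<in> A \<Longrightarrow> quasi_poly (f a)) \<Longrightarrow> quasi_poly (\<lambda>n. \<Sum>a\<in>A. f a n)"
  using quasi_poly_polynomial[of 0]
  by (induction A rule: infinite_finite_induct) (simp_all add: quasi_poly_add)

lemma pqp_one_quasi_poly:
  assumes "f \<in> pqp 1"
  shows "quasi_poly (\<lambda>n. f (\<lambda>_. int n + 1))"
  using assms
proof induction
  case (const r)
  then show ?case using quasi_poly_polynomial[of "[:r:]"] by simp
next
  case (coord i)
  then show ?case using quasi_poly_polynomial[of "[:1, 1:]"] by (simp add: add.commute)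
next
  case (periodic i m g)
  have "(int n + 1) mod m = (int (n mod nat m) + 1) mod m" for n
    using periodic by (simp add: zmod_int mod_simps)
  then show ?case
    using quasi_poly_periodic[of "nat m" "\<lambda>r. g ((int r + 1) mod m)"] periodic by simp
next
  case (pos c)
  have "0 < linform 1 c (\<lambda>_. int n + 1) \<longleftrightarrow> 0 < c 0" for n
    by (simp add: linform_def zero_less_mult_iff)
  then show ?case using quasi_poly_polynomial[of "[:of_bool (0 < c 0):]"] by simp
next
  case (add f g)
  then show ?case by (simp add: quasi_poly_add)
next
  case (mult f g)
  then show ?case by (simp add: quasi_poly_mult)
qed

section \<open>Moebius sums over tuples\<close>

fun lsum :: "'a set \<Rightarrow> nat \<Rightarrow> ('a list \<Rightarrow> real) \<Rightarrow> real" where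
  "lsum B 0 f = f []"
| "lsum B (Suc k) f = (\<Sum>z\<in>B. lsum B k (\<lambda>zs. f (z # zs)))"

text \<open>Subsequences are taken by position, so equal entries are kept apart; this is the zeta
  transform on the subsets of positions.\<close>

fun subseq_sum :: "('a list \<Rightarrow> real) \<Rightarrow> 'a list \<Rightarrow> real" where
  "subseq_sum f [] = f []"
| "subseq_sum f (z # zs) = subseq_sum f zs + subseq_sum (\<lambda>s. f (z # s)) zs"

fun indep :: "('a \<Rightarrow> 'a \<Rightarrow> bool) \<Rightarrow> 'a list \<Rightarrow> bool" where
  "indep A [] = True"
| "indep A (z # zs) = ((\<forall>v\<in>set zs. \<not> A z v) \<and> indep A zs)"

text \<open>The Moebius inverse, over subsequences, of the indicator of \<open>indep A\<close>, computed by removing the first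
  element; it vanishes if that element has no neighbour in the rest.\<close>
function (sequential) mob :: "('a \<Rightarrow> 'a \<Rightarrow> bool) \<Rightarrow> 'a list \<Rightarrow> real" where
  "mob A [] = 1"
| "mob A (z # zs) = (- 1) ^ length (filter (A z) zs) * mob A (filter (\<lambda>v. \<not> A z v) zs) - mob A zs"
  by pat_completeness auto
termination
  by (relation "measure (\<lambda>(A, zs). length zs)") (auto simp: le_imp_less_Suc)

section \<open>Algebra of sums over tuples\<close>

lemma lsum_add: "lsum B k (\<lambda>zs. f zs + g zs) = lsum B k f + lsum B k g"
  by (induction k arbitrary: f g) (simp_all add: sum.distrib)

lemma lsum_scale: "lsum B k (\<lambda>zs. c * f zs) = c * lsum B k f"
  by (induction k arbitrary: f) (simp_all add: sum_distrib_left)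

lemma lsum_diff: "lsum B k (\<lambda>zs. f zs - g zs) = lsum B k f - lsum B k g"
  by (induction k arbitrary: f g) (simp_all add: sum_subtractf)

lemma lsum_mono:
  "(\<And>zs. set zs \<subseteq> B \<Longrightarrow> length zs = k \<Longrightarrow> f zs \<le> g zs) \<Longrightarrow> lsum B k f \<le> lsum B k g"
  by (induction k arbitrary: f g) (auto intro!: sum_mono)

lemma lsum_cong:
  "(\<And>zs. set zs \<subseteq> B \<Longrightarrow> length zs = k \<Longrightarrow> f zs = g zs) \<Longrightarrow> lsum B k f = lsum B k g"
  by (intro antisym lsum_mono) auto

lemma lsum_nonneg: "(\<And>zs. 0 \<le> f zs) \<Longrightarrow> 0 \<le> lsum B k f"
  by (induction k arbitrary: f) (auto intro!: sum_nonneg)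

lemma lsum_abs: "\<bar>lsum B k f\<bar> \<le> lsum B k (\<lambda>zs. \<bar>f zs\<bar>)"
proof (induction k arbitrary: f)
  case (Suc k)
  have "\<bar>\<Sum>z\<in>B. lsum B k (\<lambda>zs. f (z # zs))\<bar> \<le> (\<Sum>z\<in>B. \<bar>lsum B k (\<lambda>zs. f (z # zs))\<bar>)"
    by (rule sum_abs)
  also have "\<dots> \<le> (\<Sum>z\<in>B. lsum B k (\<lambda>zs. \<bar>f (z # zs)\<bar>))"
    by (intro sum_mono Suc.IH)
  finally show ?case by simp
qed simp

lemma lsum_sum_swap: "(\<Sum>z\<in>C. lsum B k (f z)) = lsum B k (\<lambda>zs. \<Sum>z\<in>C. f z zs)"
proof (induction k arbitrary: f)
  case (Suc k)
  show ?case unfolding lsum.simps by (subst sum.swap) (simp add: Suc.IH)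
qed simp

lemma lsum_restrict:
  assumes "finite B"
  shows "lsum (B \<inter> C) k f = lsum B k (\<lambda>zs. of_bool (set zs \<subseteq> C) * f zs)"
proof (induction k arbitrary: f)
  case (Suc k)
  have "lsum (B \<inter> C) (Suc k) f = (\<Sum>z\<in>B \<inter> C. lsum B k (\<lambda>zs. of_bool (set zs \<subseteq> C) * f (z # zs)))"
    by (simp add: Suc.IH)
  also have "\<dots> = (\<Sum>z\<in>B. of_bool (z \<in> C) * lsum B k (\<lambda>zs. of_bool (set zs \<subseteq> C) * f (z # zs)))"
    using assms by (intro sum.mono_neutral_cong_left) auto
  also have "\<dots> = lsum B (Suc k) (\<lambda>zs. of_bool (set zs \<subseteq> C) * f zs)"
    unfolding lsum_scale[symmetric] by (auto intro!: sum.cong lsum_cong)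
  finally show ?case .
qed simp

text \<open>Pascal's rule in the form produced by peeling off the first entry of a tuple, which
  either joins the counted positions or does not.\<close>

lemma binomial_shift_sum:
  fixes F :: "nat \<Rightarrow> real"
  shows "(\<Sum>j\<le>k. real (k choose j) * F (Suc j)) + (\<Sum>j\<le>k. real (k choose j) * F j)
    = (\<Sum>j\<le>Suc k. real (Suc k choose j) * F j)"
proof -
  have "(\<Sum>j\<le>Suc k. real (Suc k choose j) * F j) = F 0 + (\<Sum>j\<le>k. real (Suc k choose Suc j) * F (Suc j))"
    by (subst sum.atMost_Suc_shift) simp
  also have "(\<Sum>j\<le>k. real (Suc k choose Suc j) * F (Suc j)) =
      (\<Sum>j\<le>k. real (k choose j) * F (Suc j)) + (\<Sum>j\<le>k. real (k choose Suc j) * F (Suc j))"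
    by (simp add: sum.distrib[symmetric] algebra_simps)
  also have "F 0 + \<dots> = (\<Sum>j\<le>k. real (k choose j) * F (Suc j)) + (\<Sum>j\<le>Suc k. real (k choose j) * F j)"
    by (subst sum.atMost_Suc_shift) simp
  also have "(\<Sum>j\<le>Suc k. real (k choose j) * F j) = (\<Sum>j\<le>k. real (k choose j) * F j)"
    by simp
  finally show ?thesis by simp
qed

text \<open>Once the \<open>k\<close> chosen positions are fixed, each of the other
  \<open>q - k\<close> entries ranges freely over \<open>B\<close>.\<close>

lemma lsum_subseq_sum:
  "lsum B q (subseq_sum f) = (\<Sum>k\<le>q. real (q choose k) * (real (card B) ^ (q - k) * lsum B k f))"
proof (induction q arbitrary: f)
  case (Suc q)
  let ?b = "real (card B)"
  have "lsum B (Suc q) (subseq_sum f) = ?b * lsum B q (subseq_sum f) + (\<Sum>z\<in>B. lsum B q (subseq_sum (\<lambda>s. f (z # s))))"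
    by (simp add: lsum_add sum.distrib)
  also have "(\<Sum>z\<in>B. lsum B q (subseq_sum (\<lambda>s. f (z # s)))) =
      (\<Sum>k\<le>q. real (q choose k) * (?b ^ (q - k) * lsum B (Suc k) f))"
    unfolding Suc.IH by (subst sum.swap) (simp add: sum_distrib_left[symmetric])
  also have "?b * lsum B q (subseq_sum f) = (\<Sum>k\<le>q. real (q choose k) * (?b ^ (Suc q - k) * lsum B k f))"
    unfolding Suc.IH sum_distrib_left by (rule sum.cong) (auto simp: Suc_diff_le)
  also have "\<dots> + (\<Sum>k\<le>q. real (q choose k) * (?b ^ (q - k) * lsum B (Suc k) f))
      = (\<Sum>k\<le>Suc q. real (Suc q choose k) * (?b ^ (Suc q - k) * lsum B k f))"
    using binomial_shift_sum[of q "\<lambda>k. ?b ^ (Suc q - k) * lsum B k f"] by simp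
  finally show ?case .
qed simp

text \<open>Sorting by the set of positions at which \<open>P\<close> holds: those \<open>j\<close>
  entries range over the part of \<open>B\<close> satisfying \<open>P\<close>, and the others form
  an arbitrary tuple in the rest.\<close>

lemma lsum_filter:
  assumes "finite B"
  shows "lsum B k (\<lambda>zs. g (length (filter P zs)) * h (filter (\<lambda>v. \<not> P v) zs)) =
    (\<Sum>j\<le>k. real (k choose j) * (g j * real (card {v\<in>B. P v}) ^ j * lsum {v\<in>B. \<not> P v} (k - j) h))"
proof (induction k arbitrary: g h)
  case (Suc k)
  let ?p = "real (card {v\<in>B. P v})" and ?R = "{v\<in>B. \<not> P v}"
  have split: "(\<Sum>z\<in>B. u z) = (\<Sum>z\<in>{v\<in>B. P v}. u z) + (\<Sum>z\<in>?R. u z)" for u :: "_ \<Rightarrow> real"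
    using assms by (subst sum.union_disjoint[symmetric]) (auto intro: sum.cong)
  have "lsum B (Suc k) (\<lambda>zs. g (length (filter P zs)) * h (filter (\<lambda>v. \<not> P v) zs))
     = ?p * lsum B k (\<lambda>zs. g (Suc (length (filter P zs))) * h (filter (\<lambda>v. \<not> P v) zs))
       + (\<Sum>z\<in>?R. lsum B k (\<lambda>zs. g (length (filter P zs)) * h (z # filter (\<lambda>v. \<not> P v) zs)))"
    unfolding lsum.simps split by simp
  also have "?p * lsum B k (\<lambda>zs. g (Suc (length (filter P zs))) * h (filter (\<lambda>v. \<not> P v) zs))
     = (\<Sum>j\<le>k. real (k choose j) * (g (Suc j) * ?p ^ Suc j * lsum ?R (Suc k - Suc j) h))"
    unfolding Suc.IH[of "\<lambda>j. g (Suc j)"] sum_distrib_left by (simp add: mult_ac)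
  also have "(\<Sum>z\<in>?R. lsum B k (\<lambda>zs. g (length (filter P zs)) * h (z # filter (\<lambda>v. \<not> P v) zs)))
     = (\<Sum>j\<le>k. real (k choose j) * (g j * ?p ^ j * lsum ?R (Suc k - j) h))"
    unfolding Suc.IH[of g "\<lambda>s. h (_ # s)"]
    by (subst sum.swap) (auto simp: Suc_diff_le sum_distrib_left[symmetric] intro!: sum.cong)
  finally show ?case
    by (simp only: binomial_shift_sum[of k "\<lambda>j. g j * ?p ^ j * lsum ?R (Suc k - j) h"])
qed simp

section \<open>Moebius inversion over subsequences\<close>

lemma subseq_sum_diff: "subseq_sum (\<lambda>s. f s - g s) zs = subseq_sum f zs - subseq_sum g zs"
  by (induction zs arbitrary: f g) simp_all

lemma subseq_sum_uminus: "subseq_sum (\<lambda>s. - f s) zs = - subseq_sum f zs"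
  by (induction zs arbitrary: f) simp_all

text \<open>Keeping or dropping an entry with \<open>P\<close> flips the sign and leaves the
  argument of \<open>h\<close> unchanged, so a single such entry makes everything cancel.\<close>

lemma subseq_sum_filter:
  "subseq_sum (\<lambda>s. (- 1) ^ length (filter P s) * h (filter (\<lambda>v. \<not> P v) s)) zs =
    (if filter P zs = [] then subseq_sum h zs else 0)"
proof (induction zs arbitrary: h)
  case (Cons z zs)
  show ?case using Cons.IH[of h] Cons.IH[of "\<lambda>s. h (z # s)"]
    by (cases "P z") (simp_all add: subseq_sum_uminus)
qed simp

text \<open>The term \<open>- mob A zs\<close> of the recursion cancels the subsequences that avoid
  \<open>z\<close>. What is left is the signed sum of \<open>subseq_sum_filter\<close>, which
  vanishes unless \<open>z\<close> has no neighbour in \<open>zs\<close>.\<close>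

lemma subseq_sum_mob: "subseq_sum (mob A) zs = of_bool (indep A zs)"
proof (induction zs)
  case (Cons z zs)
  then show ?case
    by (simp add: subseq_sum_diff subseq_sum_filter filter_empty_conv)
qed simp

lemma lsum_indep:
  "lsum B q (\<lambda>zs. of_bool (indep A zs)) =
    (\<Sum>k\<le>q. real (q choose k) * (real (card B) ^ (q - k) * lsum B k (mob A)))"
  unfolding lsum_subseq_sum[symmetric] subseq_sum_mob ..

section \<open>Growth of Moebius sums\<close>

lemma lsum_mono_set:
  assumes "finite B" "R \<subseteq> B" "\<And>zs. 0 \<le> f zs"
  shows "lsum R k f \<le> lsum B k f"
proof -
  have "lsum (B \<inter> R) k f \<le> lsum B k f"
    unfolding lsum_restrict[OF assms(1)] using assms(3) by (intro lsum_mono) auto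
  then show ?thesis using assms(2) by (simp add: Int_absorb1)
qed

text \<open>For the attack relation a square is its own neighbour: tuples may repeat squares, and
  such repetitions count as attacks.\<close>

definition nbrs :: "('a \<Rightarrow> 'a \<Rightarrow> bool) \<Rightarrow> 'a set \<Rightarrow> 'a \<Rightarrow> 'a set" where
  "nbrs A B z = {v \<in> B. A z v}"

definition hits :: "('a \<Rightarrow> 'a \<Rightarrow> bool) \<Rightarrow> 'a \<Rightarrow> 'a list \<Rightarrow> bool" where
  "hits A z zs \<longleftrightarrow> (\<exists>v\<in>set zs. A z v)"

definition abs_mob_sum :: "('a \<Rightarrow> 'a \<Rightarrow> bool) \<Rightarrow> 'a set \<Rightarrow> nat \<Rightarrow> real" where
  "abs_mob_sum A B k = lsum B k (\<lambda>zs. \<bar>mob A zs\<bar>)"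

lemma abs_mob_sum_nonneg: "0 \<le> abs_mob_sum A B k"
  unfolding abs_mob_sum_def by (rule lsum_nonneg) simp

context
  fixes A :: "'a \<Rightarrow> 'a \<Rightarrow> bool" and B :: "'a set" and D :: real
  assumes sym: "\<And>u v. A u v \<Longrightarrow> A v u" and fin: "finite B"
    and deg: "\<And>z. z \<in> B \<Longrightarrow> real (card (nbrs A B z)) \<le> D"
begin

lemma card_hits_le:
  assumes "set zs \<subseteq> B"
  shows "(\<Sum>z\<in>B. of_bool (hits A z zs)) \<le> real (length zs) * D"
proof -
  have "(\<Sum>z\<in>B. of_bool (hits A z zs)) = real (card {z\<in>B. hits A z zs})"
    using fin by (simp add: Int_def)
  also have "{z\<in>B. hits A z zs} = (\<Union>v\<in>set zs. nbrs A B v)"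
    using sym by (auto simp: hits_def nbrs_def)
  also have "real (card \<dots>) \<le> real (\<Sum>v\<in>set zs. card (nbrs A B v))"
    by (simp only: of_nat_le_iff) (rule card_UN_le, simp)
  also have "\<dots> \<le> (\<Sum>v\<in>set zs. D)"
    unfolding of_nat_sum using assms by (intro sum_mono deg) auto
  also have "\<dots> = real (card (set zs)) * D" by simp
  also have "\<dots> \<le> real (length zs) * D"
  \<comment> \<open>\<open>0 \<le> D\<close> is read off from \<open>deg\<close> at an entry of
    \<open>zs\<close>, so the empty tuple is treated apart.\<close>
  proof (cases "zs = []")
    case False
    then have "0 \<le> D" using assms deg[of "hd zs"] by (meson hd_in_set of_nat_0_le_iff order_trans subsetD)
    then show ?thesis by (intro mult_right_mono) (simp_all add: card_length)
  qed simp
  finally show ?thesis .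
qed

text \<open>Exchanging the sums fixes the tuple first; then by symmetry at most \<open>k * D\<close>
  squares \<open>z\<close> attack one of its entries. A piece tied to the others thus costs
  \<open>D\<close> instead of \<open>card B\<close>.\<close>

lemma sum_lsum_hits_le:
  "(\<Sum>z\<in>B. lsum B k (\<lambda>zs. of_bool (hits A z zs) * \<bar>mob A zs\<bar>)) \<le> real k * D * abs_mob_sum A B k"
proof -
  have "(\<Sum>z\<in>B. lsum B k (\<lambda>zs. of_bool (hits A z zs) * \<bar>mob A zs\<bar>))
     = lsum B k (\<lambda>zs. (\<Sum>z\<in>B. of_bool (hits A z zs)) * \<bar>mob A zs\<bar>)"
    by (simp only: lsum_sum_swap sum_distrib_right)
  also have "\<dots> \<le> lsum B k (\<lambda>zs. real k * D * \<bar>mob A zs\<bar>)"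
    using card_hits_le by (intro lsum_mono mult_right_mono) auto
  finally show ?thesis by (simp only: lsum_scale abs_mob_sum_def)
qed

lemma sum_nbrs_power_le:
  "(\<Sum>z\<in>B. real (card (nbrs A B z)) ^ j * lsum {v\<in>B. \<not> A z v} k (\<lambda>zs. \<bar>mob A zs\<bar>))
    \<le> real (card B) * D ^ j * abs_mob_sum A B k"
proof -
  have "(\<Sum>z\<in>B. real (card (nbrs A B z)) ^ j * lsum {v\<in>B. \<not> A z v} k (\<lambda>zs. \<bar>mob A zs\<bar>))
     \<le> (\<Sum>z\<in>B. D ^ j * abs_mob_sum A B k)"
    unfolding abs_mob_sum_def
    by (intro sum_mono mult_mono power_mono deg lsum_mono_set[OF fin] lsum_nonneg zero_le_power)
       (auto intro: order_trans[OF of_nat_0_le_iff deg])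
  then show ?thesis by simp
qed

text \<open>If the first piece hits nothing, the two terms of the recursion cancel. Otherwise one
  term leaves all other pieces, with \<open>k * D\<close> choices for the first, and the other
  deletes \<open>j \<ge> 1\<close> neighbours, with \<open>card B * D ^ j\<close> choices for the
  first piece and the deleted ones.\<close>

lemma abs_mob_sum_Suc:
  "abs_mob_sum A B (Suc k) \<le> real k * D * abs_mob_sum A B k
    + (\<Sum>j\<in>{1..k}. real (k choose j) * (real (card B) * D ^ j * abs_mob_sum A B (k - j)))"
proof -
  let ?f = "\<lambda>z zs. of_bool (0 < length (filter (A z) zs)) * \<bar>mob A (filter (\<lambda>v. \<not> A z v) zs)\<bar>"
  have pt: "\<bar>mob A (z # zs)\<bar> \<le> of_bool (hits A z zs) * \<bar>mob A zs\<bar> + ?f z zs" for z zs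
  proof (cases "hits A z zs")
    case True
    then have "filter (A z) zs \<noteq> []" by (auto simp: hits_def filter_empty_conv)
    moreover have "\<bar>mob A (z # zs)\<bar> \<le> \<bar>mob A (filter (\<lambda>v. \<not> A z v) zs)\<bar> + \<bar>mob A zs\<bar>"
      unfolding mob.simps by (rule order_trans[OF abs_triangle_ineq4]) (simp add: abs_mult power_abs)
    ultimately show ?thesis using True by simp
  next
    case False
    then have "filter (A z) zs = []" "filter (\<lambda>v. \<not> A z v) zs = zs"
      by (auto simp: hits_def filter_empty_conv filter_id_conv)
    then show ?thesis by simp
  qed
  have "abs_mob_sum A B (Suc k) \<le> (\<Sum>z\<in>B. lsum B k (\<lambda>zs. of_bool (hits A z zs) * \<bar>mob A zs\<bar>)) + (\<Sum>z\<in>B. lsum B k (?f z))"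
    unfolding abs_mob_sum_def lsum.simps lsum_add[symmetric] sum.distrib[symmetric]
    by (intro sum_mono lsum_mono pt)
  also have "(\<Sum>z\<in>B. lsum B k (?f z)) = (\<Sum>z\<in>B. \<Sum>j\<le>k. real (k choose j) * (of_bool (0 < j) * real (card (nbrs A B z)) ^ j
      * lsum {v\<in>B. \<not> A z v} (k - j) (\<lambda>zs. \<bar>mob A zs\<bar>)))"
    unfolding nbrs_def
    by (intro sum.cong[OF refl] lsum_filter[OF fin, where g = "\<lambda>j. of_bool (0 < j)" and h = "\<lambda>zs. \<bar>mob A zs\<bar>"])
  also have "\<dots> = (\<Sum>j\<le>k. \<Sum>z\<in>B. real (k choose j) * (of_bool (0 < j) * real (card (nbrs A B z)) ^ j
      * lsum {v\<in>B. \<not> A z v} (k - j) (\<lambda>zs. \<bar>mob A zs\<bar>)))"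
    by (rule sum.swap)
  also have "\<dots> = (\<Sum>j\<in>{1..k}. real (k choose j) * (\<Sum>z\<in>B. real (card (nbrs A B z)) ^ j
      * lsum {v\<in>B. \<not> A z v} (k - j) (\<lambda>zs. \<bar>mob A zs\<bar>)))"
    by (rule sum.mono_neutral_cong_right) (auto simp: sum_distrib_left)
  also have "\<dots> \<le> (\<Sum>j\<in>{1..k}. real (k choose j) * (real (card B) * D ^ j * abs_mob_sum A B (k - j)))"
    by (intro sum_mono mult_left_mono sum_nbrs_power_le) auto
  finally show ?thesis using sum_lsum_hits_le[of k] by linarith
qed

text \<open>Replaces the board depleted around \<open>z\<close> by the full board, at the price of
  tuples hit by \<open>z\<close>, which are of lower order after summation over
  \<open>z\<close>.\<close>

lemma lsum_nonnbrs:
  "lsum {v\<in>B. \<not> A z v} k (mob A) = lsum B k (mob A) - lsum B k (\<lambda>zs. of_bool (hits A z zs) * mob A zs)"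
proof -
  have "{v\<in>B. \<not> A z v} = B \<inter> {v. \<not> A z v}" by auto
  then have "lsum {v\<in>B. \<not> A z v} k (mob A) = lsum B k (\<lambda>zs. of_bool (set zs \<subseteq> {v. \<not> A z v}) * mob A zs)"
    by (simp only: lsum_restrict[OF fin])
  also have "\<dots> = lsum B k (\<lambda>zs. mob A zs - of_bool (hits A z zs) * mob A zs)"
    by (rule lsum_cong) (auto simp: hits_def)
  finally show ?thesis by (simp only: lsum_diff)
qed

lemma abs_lsum_hits_le:
  "\<bar>lsum B k (\<lambda>zs. of_bool (hits A z zs) * mob A zs)\<bar> \<le> lsum B k (\<lambda>zs. of_bool (hits A z zs) * \<bar>mob A zs\<bar>)"
  using lsum_abs[of B k "\<lambda>zs. of_bool (hits A z zs) * mob A zs"] by (simp add: abs_mult)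

text \<open>In the recursion for \<^const>\<open>mob\<close>, the first piece having exactly one neighbour gives the main term.\<close>
lemma mob_sum_recurrence:
  "\<bar>lsum B (Suc (Suc k)) (mob A) + real (Suc k) * (\<Sum>z\<in>B. real (card (nbrs A B z))) * lsum B k (mob A)\<bar>
    \<le> real (Suc k) * D * abs_mob_sum A B (Suc k) + real (Suc k) * (D * (real k * D * abs_mob_sum A B k))
      + (\<Sum>j\<in>{2..Suc k}. real (Suc k choose j) * (real (card B) * D ^ j * abs_mob_sum A B (Suc k - j)))"
proof -
  let ?p = "\<lambda>z. real (card (nbrs A B z))"
  let ?t = "\<lambda>z j. real (Suc k choose j) * ((- 1) ^ j * ?p z ^ j * lsum {v\<in>B. \<not> A z v} (Suc k - j) (mob A))"
  let ?e = "\<lambda>z k. lsum B k (\<lambda>zs. of_bool (hits A z zs) * mob A zs)"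
  let ?e' = "\<lambda>z k. lsum B k (\<lambda>zs. of_bool (hits A z zs) * \<bar>mob A zs\<bar>)"
  have z: "lsum B (Suc k) (\<lambda>zs. mob A (z # zs)) + real (Suc k) * ?p z * lsum B k (mob A)
     = - ?e z (Suc k) + real (Suc k) * ?p z * ?e z k + (\<Sum>j\<in>{2..Suc k}. ?t z j)" for z
  proof -
    have "lsum B (Suc k) (\<lambda>zs. mob A (z # zs)) = (\<Sum>j\<le>Suc k. ?t z j) - lsum B (Suc k) (mob A)"
      unfolding mob.simps lsum_diff nbrs_def
      by (subst lsum_filter[OF fin, where g = "\<lambda>j. (- 1) ^ j" and h = "mob A"]) (rule refl)
    \<comment> \<open>The term \<open>j = 0\<close> cancels the subtracted sum and
      \<open>j = 1\<close> is the main term, both up to tuples hit by \<open>z\<close>; the terms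
      with \<open>j \<ge> 2\<close> are pure error.\<close>
    also have "(\<Sum>j\<le>Suc k. ?t z j) = ?t z 0 + ?t z 1 + (\<Sum>j\<in>{2..Suc k}. ?t z j)"
    proof -
      have "{..Suc k} = insert 0 (insert 1 {2..Suc k})" by auto
      then show ?thesis by simp
    qed
    finally show ?thesis by (simp add: lsum_nonnbrs algebra_simps del: lsum.simps)
  qed
  have "lsum B (Suc (Suc k)) (mob A) + real (Suc k) * (\<Sum>z\<in>B. ?p z) * lsum B k (mob A)
     = (\<Sum>z\<in>B. lsum B (Suc k) (\<lambda>zs. mob A (z # zs)) + real (Suc k) * ?p z * lsum B k (mob A))"
    by (simp only: lsum.simps(2)[of B "Suc k"] sum.distrib sum_distrib_left sum_distrib_right)
  also have "\<dots> = (\<Sum>z\<in>B. - ?e z (Suc k)) + (\<Sum>z\<in>B. real (Suc k) * ?p z * ?e z k) + (\<Sum>z\<in>B. \<Sum>j\<in>{2..Suc k}. ?t z j)"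
    unfolding z by (simp only: sum.distrib)
  finally have eq: "lsum B (Suc (Suc k)) (mob A) + real (Suc k) * (\<Sum>z\<in>B. ?p z) * lsum B k (mob A) = \<dots>" .
  have 1: "\<bar>\<Sum>z\<in>B. - ?e z (Suc k)\<bar> \<le> real (Suc k) * D * abs_mob_sum A B (Suc k)"
  proof -
    have "\<bar>\<Sum>z\<in>B. - ?e z (Suc k)\<bar> \<le> (\<Sum>z\<in>B. ?e' z (Suc k))"
      by (rule order_trans[OF sum_abs]) (simp only: abs_minus_cancel, intro sum_mono abs_lsum_hits_le)
    then show ?thesis using sum_lsum_hits_le[of "Suc k"] by (rule order_trans)
  qed
  have 2: "\<bar>\<Sum>z\<in>B. real (Suc k) * ?p z * ?e z k\<bar> \<le> real (Suc k) * (D * (real k * D * abs_mob_sum A B k))"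
  proof (cases "B = {}")
    case False
    then have D: "0 \<le> D" using deg by (meson ex_in_conv of_nat_0_le_iff order_trans)
    have "\<bar>\<Sum>z\<in>B. real (Suc k) * ?p z * ?e z k\<bar> \<le> (\<Sum>z\<in>B. real (Suc k) * (D * ?e' z k))"
    proof (rule order_trans[OF sum_abs], rule sum_mono)
      fix z assume "z \<in> B"
      then have "?p z * \<bar>?e z k\<bar> \<le> D * ?e' z k"
        using D by (intro mult_mono deg abs_lsum_hits_le) auto
      then show "\<bar>real (Suc k) * ?p z * ?e z k\<bar> \<le> real (Suc k) * (D * ?e' z k)"
        unfolding abs_mult mult.assoc by (simp add: mult_left_mono)
    qed
    also have "\<dots> = real (Suc k) * (D * (\<Sum>z\<in>B. ?e' z k))" by (simp only: sum_distrib_left)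
    also have "\<dots> \<le> real (Suc k) * (D * (real k * D * abs_mob_sum A B k))"
      using D by (intro mult_left_mono sum_lsum_hits_le) auto
    finally show ?thesis .
  next
    \<comment> \<open>On an empty board \<open>D\<close> may be negative, but the bound is zero: by
      the factor \<open>real k\<close> if \<open>k = 0\<close>, and by an empty sum
      otherwise.\<close>
    case True
    then show ?thesis by (cases k) (simp_all add: abs_mob_sum_def)
  qed
  have 3: "\<bar>\<Sum>z\<in>B. \<Sum>j\<in>{2..Suc k}. ?t z j\<bar> \<le>
      (\<Sum>j\<in>{2..Suc k}. real (Suc k choose j) * (real (card B) * D ^ j * abs_mob_sum A B (Suc k - j)))"
  proof -
    have t: "\<bar>?t z j\<bar> \<le> real (Suc k choose j) * (?p z ^ j * lsum {v\<in>B. \<not> A z v} (Suc k - j) (\<lambda>zs. \<bar>mob A zs\<bar>))" for z j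
      unfolding abs_mult by (intro mult_mono lsum_abs) (auto simp: power_abs intro!: mult_nonneg_nonneg lsum_nonneg)
    have "\<bar>\<Sum>z\<in>B. \<Sum>j\<in>{2..Suc k}. ?t z j\<bar> \<le> (\<Sum>z\<in>B. \<Sum>j\<in>{2..Suc k}. \<bar>?t z j\<bar>)"
      by (rule order_trans[OF sum_abs sum_mono[OF sum_abs]])
    also have "\<dots> \<le> (\<Sum>z\<in>B. \<Sum>j\<in>{2..Suc k}. real (Suc k choose j) * (?p z ^ j * lsum {v\<in>B. \<not> A z v} (Suc k - j) (\<lambda>zs. \<bar>mob A zs\<bar>)))"
      by (intro sum_mono t)
    also have "\<dots> = (\<Sum>j\<in>{2..Suc k}. real (Suc k choose j) * (\<Sum>z\<in>B. ?p z ^ j * lsum {v\<in>B. \<not> A z v} (Suc k - j) (\<lambda>zs. \<bar>mob A zs\<bar>)))"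
      by (subst sum.swap) (simp only: sum_distrib_left)
    also have "\<dots> \<le> (\<Sum>j\<in>{2..Suc k}. real (Suc k choose j) * (real (card B) * D ^ j * abs_mob_sum A B (Suc k - j)))"
      by (intro sum_mono mult_left_mono sum_nbrs_power_le) auto
    finally show ?thesis .
  qed
  show ?thesis unfolding eq using 1 2 3 by linarith
qed

end

section \<open>Orders of growth and leading coefficients\<close>

lemma power_bigo_mono: "a \<le> b \<Longrightarrow> (\<lambda>n. real n ^ a) \<in> O(\<lambda>n. real n ^ b)"
  by (intro landau_o.big_mono eventually_mono[OF eventually_ge_at_top[of 1]]) (auto intro: power_increasing)

lemma bigo_power_trans: "f \<in> O(\<lambda>n. real n ^ a) \<Longrightarrow> a \<le> b \<Longrightarrow> f \<in> O(\<lambda>n. real n ^ b)"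
  using power_bigo_mono landau_o.big_trans by blast

lemma bigo_power_mult:
  "f \<in> O(\<lambda>n. real n ^ a) \<Longrightarrow> g \<in> O(\<lambda>n. real n ^ b) \<Longrightarrow> (\<lambda>n. f n * g n) \<in> O(\<lambda>n. real n ^ (a + b))"
  unfolding power_add by (rule landau_o.big.mult)

lemma const_bigo_power0: "(\<lambda>n. c :: real) \<in> O(\<lambda>n. real n ^ 0)"
  by simp

lemma bigo_power_tendsto_0:
  assumes "f \<in> O(\<lambda>n. real n ^ a)" "a < b"
  shows "(\<lambda>n. f n / real n ^ b) \<longlonglongrightarrow> 0"
proof -
  obtain c where c: "0 < c" "eventually (\<lambda>n. norm (f n) \<le> c * norm (real n ^ a)) sequentially"
    using assms(1) by (elim landau_o.bigE)
  have "eventually (\<lambda>n. norm (f n / real n ^ b) \<le> norm (inverse (real n)) * c) sequentially"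
    using c(2) eventually_ge_at_top[of 1]
  proof eventually_elim
    case (elim n)
    have "norm (f n / real n ^ b) \<le> c * real n ^ a / real n ^ b"
      using elim by (simp add: abs_divide divide_right_mono)
    also have "\<dots> \<le> c * real n ^ a / real n ^ Suc a"
      using elim c assms(2) by (intro divide_left_mono power_increasing mult_pos_pos) auto
    also have "\<dots> = norm (inverse (real n)) * c" using elim by (simp add: field_simps)
    finally show ?case .
  qed
  then show ?thesis by (rule tendsto_0_le[OF lim_inverse_n])
qed

lemma poly_eq_sum_coeff:
  fixes p :: "real poly"
  assumes "degree p \<le> d"
  shows "poly p x = (\<Sum>i\<le>d. coeff p i * x ^ i)"
  unfolding poly_altdef using assms
  by (intro sum.mono_neutral_left) (auto simp: coeff_eq_0)

lemma poly_div_power_tendsto: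
  fixes Q :: "real poly"
  assumes "degree Q \<le> d"
  shows "(\<lambda>n. poly Q (real n) / real n ^ d) \<longlonglongrightarrow> coeff Q d"
proof -
  have "(\<lambda>n. (poly Q (real n) - coeff Q d * real n ^ d) / real n ^ d) \<longlonglongrightarrow> 0"
  proof (cases d)
    case 0
    then have "poly Q x = coeff Q d" for x using assms by (simp add: poly_altdef)
    then show ?thesis using 0 by simp
  next
    case (Suc e)
    have "poly Q x - coeff Q d * x ^ d = (\<Sum>i\<le>e. coeff Q i * x ^ i)" for x
      unfolding poly_eq_sum_coeff[OF assms] Suc by simp
    moreover have "(\<lambda>n. \<Sum>i\<le>e. coeff Q i * real n ^ i) \<in> O(\<lambda>n. real n ^ e)"
      by (intro big_sum_in_bigo bigo_power_trans[OF bigo_power_mult[OF const_bigo_power0 power_bigo_mono[OF order_refl]]]) auto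
    ultimately show ?thesis using bigo_power_tendsto_0[of _ e d] Suc by simp
  qed
  then have "(\<lambda>n. (poly Q (real n) - coeff Q d * real n ^ d) / real n ^ d + coeff Q d) \<longlonglongrightarrow> 0 + coeff Q d"
    by (intro tendsto_intros)
  moreover have "eventually (\<lambda>n. (poly Q (real n) - coeff Q d * real n ^ d) / real n ^ d + coeff Q d
      = poly Q (real n) / real n ^ d) sequentially"
    using eventually_ge_at_top[of 1] by eventually_elim (simp add: field_simps)
  ultimately show ?thesis by (simp add: tendsto_cong)
qed

text \<open>Along \<open>n = p * m + r\<close> the function is a single polynomial, whose normalized
  values tend to its coefficient at \<open>d\<close>. The limit over all \<open>n\<close> is also
  the limit along this subsequence, so the coefficient does not depend on \<open>r\<close>.\<close>

lemma quasi_poly_subseq_tendsto: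
  assumes f: "\<And>n. f n = poly (P (n mod p)) (real n)" and r: "r < p" and lim: "(\<lambda>n. f n / real n ^ d) \<longlonglongrightarrow> l"
    and deg: "degree (P r) \<le> d"
  shows "coeff (P r) d = (l :: real)"
proof -
  have sm: "strict_mono (\<lambda>m. p * m + r)" using r by (intro strict_monoI) simp
  have "(\<lambda>m. f (p * m + r) / real (p * m + r) ^ d) \<longlonglongrightarrow> l"
    using LIMSEQ_subseq_LIMSEQ[OF lim sm] by (simp add: o_def)
  moreover have "f (p * m + r) = poly (P r) (real (p * m + r))" for m
    unfolding f using r by simp
  ultimately have "(\<lambda>m. poly (P r) (real (p * m + r)) / real (p * m + r) ^ d) \<longlonglongrightarrow> l" by simp
  moreover have "(\<lambda>m. poly (P r) (real (p * m + r)) / real (p * m + r) ^ d) \<longlonglongrightarrow> coeff (P r) d"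
    using LIMSEQ_subseq_LIMSEQ[OF poly_div_power_tendsto[OF deg] sm] by (simp add: o_def)
  ultimately show ?thesis by (rule LIMSEQ_unique[symmetric])
qed

text \<open>If the degree exceeded \<open>e\<close>, dividing by that power would send the function
  to 0 and so annihilate the leading coefficient.\<close>

lemma quasi_poly_degree_le:
  assumes f: "\<And>n. f n = poly (P (n mod p)) (real n)" and r: "r < p" and O: "f \<in> O(\<lambda>n. real n ^ e)"
  shows "degree (P r) \<le> e"
proof (rule ccontr)
  assume "\<not> degree (P r) \<le> e"
  then have "coeff (P r) (degree (P r)) = 0"
    using O by (intro quasi_poly_subseq_tendsto[OF f r] bigo_power_tendsto_0[of f e]) auto
  then show False using \<open>\<not> degree (P r) \<le> e\<close> by simp
qed

context
  fixes A :: "'a \<Rightarrow> 'a \<Rightarrow> bool" and B :: "nat \<Rightarrow> 'a set" and C :: real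
  assumes sym: "\<And>u v. A u v \<Longrightarrow> A v u" and fin: "\<And>n. finite (B n)"
    and card_B: "\<And>n. card (B n) = n\<^sup>2"
    and deg: "\<And>n z. z \<in> B n \<Longrightarrow> real (card (nbrs A (B n) z)) \<le> C * real n"
begin

lemma abs_mob_sum_bigo: "(\<lambda>n. abs_mob_sum A (B n) k) \<in> O(\<lambda>n. real n ^ (k + k div 2))"
proof (induction k rule: less_induct)
  case (less k)
  show ?case
  proof (cases k)
    case 0
    then show ?thesis by (simp add: abs_mob_sum_def)
  next
    case (Suc k')
    have D: "(\<lambda>n. C * real n) \<in> O(\<lambda>n. real n ^ 1)" by simp
    have Dj: "(\<lambda>n. (C * real n) ^ j) \<in> O(\<lambda>n. real n ^ j)" for j
      using landau_o.big_power[OF D, of j] by simp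
    have N: "(\<lambda>n. real (card (B n))) \<in> O(\<lambda>n. real n ^ 2)" by (simp add: card_B)
    let ?R = "\<lambda>n. real k' * (C * real n) * abs_mob_sum A (B n) k' +
      (\<Sum>j\<in>{1..k'}. real (k' choose j) * (real (card (B n)) * (C * real n) ^ j * abs_mob_sum A (B n) (k' - j)))"
    have "?R \<in> O(\<lambda>n. real n ^ (k + k div 2))"
    proof (intro sum_in_bigo big_sum_in_bigo)
      have "(\<lambda>n. real k' * (C * real n) * abs_mob_sum A (B n) k') \<in> O(\<lambda>n. real n ^ (0 + 1 + (k' + k' div 2)))"
        using less.IH[of k'] Suc by (intro bigo_power_mult const_bigo_power0 D) auto
      then show "(\<lambda>n. real k' * (C * real n) * abs_mob_sum A (B n) k') \<in> O(\<lambda>n. real n ^ (k + k div 2))"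
        by (rule bigo_power_trans) (simp add: Suc)
    next
      fix j assume j: "j \<in> {1..k'}"
      have "(\<lambda>n. real (k' choose j) * (real (card (B n)) * (C * real n) ^ j * abs_mob_sum A (B n) (k' - j)))
         \<in> O(\<lambda>n. real n ^ (0 + (2 + j + ((k' - j) + (k' - j) div 2))))"
        using less.IH[of "k' - j"] Suc by (intro bigo_power_mult const_bigo_power0 Dj N) auto
      then show "(\<lambda>n. real (k' choose j) * (real (card (B n)) * (C * real n) ^ j * abs_mob_sum A (B n) (k' - j)))
         \<in> O(\<lambda>n. real n ^ (k + k div 2))"
      proof (rule bigo_power_trans)
        \<comment> \<open>The worst case is \<open>j = 1\<close>: two pieces forming an edge account
          for exponent 3, exactly the growth of \<open>k + k div 2\<close> over two steps.\<close>
        have "(k' - j) div 2 \<le> (k' - 1) div 2" using j by (intro div_le_mono) auto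
        moreover have "Suc ((k' - 1) div 2) = Suc k' div 2" using j by (cases k') auto
        ultimately show "0 + (2 + j + ((k' - j) + (k' - j) div 2)) \<le> k + k div 2"
          using j unfolding Suc by auto
      qed
    qed
    moreover have "norm (abs_mob_sum A (B n) k) \<le> norm (?R n)" for n
      using abs_mob_sum_Suc[OF sym fin deg, of n k'] abs_mob_sum_nonneg[of A "B n" k] unfolding Suc by simp
    ultimately show ?thesis by (rule landau_o.big_trans[OF landau_o.big_mono[OF always_eventually[OF allI]], rotated])
  qed
qed

lemma mob_sum_bigo: "(\<lambda>n. lsum (B n) k (mob A)) \<in> O(\<lambda>n. real n ^ (k + k div 2))"
proof (rule landau_o.big_trans[OF landau_o.big_mono abs_mob_sum_bigo], rule always_eventually, rule allI)
  fix n
  show "norm (lsum (B n) k (mob A)) \<le> norm (abs_mob_sum A (B n) k)"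
    using lsum_abs[of "B n" k "mob A"] abs_mob_sum_nonneg[of A "B n" k] by (simp add: abs_mob_sum_def)
qed

text \<open>The first of \<open>2 * i + 2\<close> pieces has \<open>2 * i + 1\<close> possible
  partners, and each edge contributes minus the number of attacking ordered pairs. Iteration yields
  the product of odd numbers that counts perfect matchings.\<close>

lemma mob_sum_even_tendsto:
  assumes lim: "(\<lambda>n. (\<Sum>z\<in>B n. real (card (nbrs A (B n) z))) / real n ^ 3) \<longlonglongrightarrow> \<alpha>"
  shows "(\<lambda>n. lsum (B n) (2 * i) (mob A) / real n ^ (3 * i)) \<longlonglongrightarrow> (\<Prod>l<i. - (2 * real l + 1) * \<alpha>)"
proof (induction i)
  case 0
  then show ?case by simp
next
  case (Suc i)
  let ?k = "2 * i"
  let ?w = "\<lambda>n. lsum (B n) ?k (mob A)" and ?s = "\<lambda>n. \<Sum>z\<in>B n. real (card (nbrs A (B n) z))"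
  let ?E = "\<lambda>n. lsum (B n) (Suc (Suc ?k)) (mob A) + real (Suc ?k) * ?s n * ?w n"
  have D: "(\<lambda>n. C * real n) \<in> O(\<lambda>n. real n ^ 1)" by simp
  have Dj: "(\<lambda>n. (C * real n) ^ j) \<in> O(\<lambda>n. real n ^ j)" for j
    using landau_o.big_power[OF D, of j] by simp
  have N: "(\<lambda>n. real (card (B n))) \<in> O(\<lambda>n. real n ^ 2)" by (simp add: card_B)
  let ?R = "\<lambda>n. real (Suc ?k) * (C * real n) * abs_mob_sum A (B n) (Suc ?k)
      + real (Suc ?k) * ((C * real n) * (real ?k * (C * real n) * abs_mob_sum A (B n) ?k))
      + (\<Sum>j\<in>{2..Suc ?k}. real (Suc ?k choose j) * (real (card (B n)) * (C * real n) ^ j * abs_mob_sum A (B n) (Suc ?k - j)))"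
  \<comment> \<open>One power of \<open>n\<close> below the main order \<open>3 * Suc i\<close>. A
    first piece with at least two deleted neighbours leaves too few pieces to attain it.\<close>
  have "?R \<in> O(\<lambda>n. real n ^ (3 * i + 2))"
  proof (intro sum_in_bigo big_sum_in_bigo)
    have "(\<lambda>n. real (Suc ?k) * (C * real n) * abs_mob_sum A (B n) (Suc ?k)) \<in> O(\<lambda>n. real n ^ (0 + 1 + (Suc ?k + Suc ?k div 2)))"
      by (intro bigo_power_mult const_bigo_power0 D abs_mob_sum_bigo)
    then show "(\<lambda>n. real (Suc ?k) * (C * real n) * abs_mob_sum A (B n) (Suc ?k)) \<in> O(\<lambda>n. real n ^ (3 * i + 2))"
      by (rule bigo_power_trans) simp
    have "(\<lambda>n. real (Suc ?k) * ((C * real n) * (real ?k * (C * real n) * abs_mob_sum A (B n) ?k)))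
       \<in> O(\<lambda>n. real n ^ (0 + (1 + (0 + 1 + (?k + ?k div 2)))))"
      by (intro bigo_power_mult const_bigo_power0 D abs_mob_sum_bigo)
    then show "(\<lambda>n. real (Suc ?k) * ((C * real n) * (real ?k * (C * real n) * abs_mob_sum A (B n) ?k)))
       \<in> O(\<lambda>n. real n ^ (3 * i + 2))"
      by (rule bigo_power_trans) simp
  next
    fix j assume j: "j \<in> {2..Suc ?k}"
    have "(\<lambda>n. real (Suc ?k choose j) * (real (card (B n)) * (C * real n) ^ j * abs_mob_sum A (B n) (Suc ?k - j)))
       \<in> O(\<lambda>n. real n ^ (0 + (2 + j + ((Suc ?k - j) + (Suc ?k - j) div 2))))"
      by (intro bigo_power_mult const_bigo_power0 Dj N abs_mob_sum_bigo)
    then show "(\<lambda>n. real (Suc ?k choose j) * (real (card (B n)) * (C * real n) ^ j * abs_mob_sum A (B n) (Suc ?k - j)))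
       \<in> O(\<lambda>n. real n ^ (3 * i + 2))"
    proof (rule bigo_power_trans)
      have "(Suc ?k - j) div 2 \<le> (Suc ?k - 2) div 2" using j by (intro div_le_mono) auto
      then show "0 + (2 + j + ((Suc ?k - j) + (Suc ?k - j) div 2)) \<le> 3 * i + 2"
        using j by (cases i) auto
    qed
  qed
  moreover have "norm (?E n) \<le> norm (?R n)" for n
    using mob_sum_recurrence[OF sym fin deg, of n ?k] by (simp del: lsum.simps)
  ultimately have "?E \<in> O(\<lambda>n. real n ^ (3 * i + 2))"
    by (rule landau_o.big_trans[OF landau_o.big_mono[OF always_eventually[OF allI]], rotated])
  then have "(\<lambda>n. ?E n / real n ^ (3 * Suc i)) \<longlonglongrightarrow> 0"
    by (rule bigo_power_tendsto_0) simp
  then have "(\<lambda>n. ?E n / real n ^ (3 * Suc i) - real (Suc ?k) * (?s n / real n ^ 3) * (?w n / real n ^ (3 * i)))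
     \<longlonglongrightarrow> 0 - real (Suc ?k) * \<alpha> * (\<Prod>l<i. - (2 * real l + 1) * \<alpha>)"
    by (intro tendsto_intros lim Suc.IH)
  moreover have "?E n / real n ^ (3 * Suc i) - real (Suc ?k) * (?s n / real n ^ 3) * (?w n / real n ^ (3 * i))
     = lsum (B n) (2 * Suc i) (mob A) / real n ^ (3 * Suc i)" for n
    by (simp add: add_divide_distrib power_add del: lsum.simps)
  moreover have "0 - real (Suc ?k) * \<alpha> * (\<Prod>l<i. - (2 * real l + 1) * \<alpha>) = (\<Prod>l<Suc i. - (2 * real l + 1) * \<alpha>)"
    by (simp add: algebra_simps)
  ultimately show ?case by (simp only:)
qed

end

section \<open>Non-attacking placements\<close>

lemma pqp_eq_0: "(\<lambda>x. of_bool (linform d c x = 0)) \<in> pqp d"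
proof -
  have "(\<lambda>x. of_bool (0 \<le> linform d c x) - of_bool (0 < linform d c x)) \<in> pqp d"
    by (intro pqp_diff pqp_nonneg pqp.pos)
  moreover have "of_bool (0 \<le> linform d c x) - of_bool (0 < linform d c x) = (of_bool (linform d c x = 0) :: real)" for x
    by auto
  ultimately show ?thesis by simp
qed

text \<open>Primitivity of the basic moves makes the parameter of a multiple redundant.\<close>
lemma attacks_iff:
  assumes "M \<subseteq> nightrider_moves"
  shows "attacks M z v \<longleftrightarrow> (\<exists>m\<in>M. fst m * (snd v - snd z) = snd m * (fst v - fst z))"
proof -
  have "(\<exists>t::int. dx = t * fst m \<and> dy = t * snd m) \<longleftrightarrow> fst m * dy = snd m * dx"
    if "m \<in> M" for m dx dy
  proof -
    have "m = (1,2) \<or> m = (2,1) \<or> m = (1,-2) \<or> m = (2,-1)"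
      using assms that by (auto simp: nightrider_moves_def)
    then show ?thesis by (elim disjE) (simp; presburger)+
  qed
  then show ?thesis unfolding attacks_def by blast
qed

lemma attacks_sym: "attacks M u v \<Longrightarrow> attacks M v u"
proof -
  assume "attacks M u v"
  then obtain t m where m: "m \<in> M" and t: "fst v - fst u = t * fst m" "snd v - snd u = t * snd m"
    unfolding attacks_def by blast
  have "fst u - fst v = (- t) * fst m" "snd u - snd v = (- t) * snd m" using t by simp_all
  with m show "attacks M v u" unfolding attacks_def by blast
qed

lemma attacks_refl: "M \<noteq> {} \<Longrightarrow> attacks M z z"
  unfolding attacks_def by (intro exI[of _ 0]) auto

lemma finite_board [simp]: "finite (board n)"
  by (simp add: board_def)

lemma card_board: "card (board n) = n\<^sup>2"
  by (simp add: board_def power2_eq_square)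

text \<open>Coordinate 0 is reserved for the summation bound, hence the offsets 1 and 2.\<close>

definition piece :: "(nat \<Rightarrow> int) \<Rightarrow> nat \<Rightarrow> int \<times> int" where
  "piece x i = (x (2 * i + 1), x (2 * i + 2))"

text \<open>The \<open>j\<close> pieces already stored in \<open>x\<close> are carried along so that
  the induction can place one piece, that is two coordinates, at a time. The value
  \<open>x 0 = int n + 1\<close> turns the strict range into \<open>{1..int n}\<close>.\<close>

lemma itsum_eq_lsum:
  assumes "x 0 = int n + 1"
  shows "itsum (2 * j + 1) (2 * k) (\<lambda>x. G (map (piece x) [0..<j + k])) x
    = lsum (board n) k (\<lambda>zs. G (map (piece x) [0..<j] @ zs))"
  using assms
proof (induction k arbitrary: j x)
  case 0
  then show ?case by simp
next
  case (Suc k)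
  let ?x = "\<lambda>u v. x(2 * j + 1 := u, 2 * j + 2 := v)"
  have map: "map (piece (?x u v)) [0..<Suc j] = map (piece x) [0..<j] @ [(u, v)]" for u v
    by (simp add: piece_def)
  have ivl: "{0<..<x 0} = {1..int n}" using Suc.prems by auto
  have two: "2 * Suc k = Suc (Suc (2 * k))" by simp
  have "itsum (2 * j + 1) (2 * Suc k) (\<lambda>x. G (map (piece x) [0..<j + Suc k])) x
    = (\<Sum>u\<in>{1..int n}. \<Sum>v\<in>{1..int n}. itsum (2 * Suc j + 1) (2 * k) (\<lambda>x. G (map (piece x) [0..<Suc j + k])) (?x u v))"
    unfolding two itsum.simps ivl[symmetric] by simp
  also have "\<dots> = (\<Sum>u\<in>{1..int n}. \<Sum>v\<in>{1..int n}. lsum (board n) k (\<lambda>zs. G (map (piece x) [0..<j] @ (u, v) # zs)))"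
  proof (intro sum.cong refl)
    fix u v
    have "?x u v 0 = int n + 1" using Suc.prems by simp
    then show "itsum (2 * Suc j + 1) (2 * k) (\<lambda>x. G (map (piece x) [0..<Suc j + k])) (?x u v)
      = lsum (board n) k (\<lambda>zs. G (map (piece x) [0..<j] @ (u, v) # zs))"
      by (subst Suc.IH) (simp_all only: map append.assoc append.simps)
  qed
  also have "\<dots> = lsum (board n) (Suc k) (\<lambda>zs. G (map (piece x) [0..<j] @ zs))"
    by (simp add: board_def sum.cartesian_product case_prod_beta)
  finally show ?case .
qed

lemma indep_append: "indep A (zs @ [v]) \<longleftrightarrow> indep A zs \<and> (\<forall>u\<in>set zs. \<not> A u v)"
  by (induction zs) auto

lemma pqp_indep_pieces:
  assumes M: "M \<subseteq> nightrider_moves" and "2 * q < d"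
  shows "(\<lambda>x. of_bool (indep (attacks M) (map (piece x) [0..<q]))) \<in> pqp d"
  using assms(2)
proof (induction q)
  case 0
  then show ?case by (simp add: pqp.const)
next
  case (Suc q)
  have finM: "finite M" using M by (rule finite_subset) (simp add: nightrider_moves_def)
  \<comment> \<open>Coefficients of the linear form whose vanishing says that pieces
    \<open>i\<close> and \<open>q\<close> are aligned in direction \<open>m\<close>; it has no
    constant term, so its wall is homogeneous.\<close>
  define c :: "int \<times> int \<Rightarrow> nat \<Rightarrow> nat \<Rightarrow> int" where
    "c m i j = fst m * (of_bool (j = 2 * q + 2) - of_bool (j = 2 * i + 2))
      - snd m * (of_bool (j = 2 * q + 1) - of_bool (j = 2 * i + 1))" for m i j
  have c: "linform d (c m i) x = fst m * (snd (piece x q) - snd (piece x i)) - snd m * (fst (piece x q) - fst (piece x i))"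
    if "i < q" for m i x
  proof -
    have coord: "(\<Sum>j<d. of_bool (j = e) * x j) = x e" if "e < d" for e
      using that by simp
    have "linform d (c m i) x = fst m * ((\<Sum>j<d. of_bool (j = 2 * q + 2) * x j) - (\<Sum>j<d. of_bool (j = 2 * i + 2) * x j))
       - snd m * ((\<Sum>j<d. of_bool (j = 2 * q + 1) * x j) - (\<Sum>j<d. of_bool (j = 2 * i + 1) * x j))"
      unfolding linform_def c_def
      by (simp only: left_diff_distrib mult.assoc sum_subtractf sum_distrib_left right_diff_distrib)
    moreover have "2 * q + 2 < d" "2 * q + 1 < d" "2 * i + 2 < d" "2 * i + 1 < d"
      using Suc.prems that by auto
    ultimately show ?thesis by (simp only: coord piece_def fst_conv snd_conv)
  qed
  have "(\<lambda>x. of_bool (indep (attacks M) (map (piece x) [0..<q])) *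
      (\<Prod>i<q. \<Prod>m\<in>M. 1 - of_bool (linform d (c m i) x = 0))) \<in> pqp d"
    using Suc by (intro pqp.mult pqp_prod pqp_diff pqp.const pqp_eq_0) auto
  moreover have "of_bool (indep (attacks M) (map (piece x) [0..<q])) *
      (\<Prod>i<q. \<Prod>m\<in>M. 1 - of_bool (linform d (c m i) x = 0))
      = (of_bool (indep (attacks M) (map (piece x) [0..<Suc q])) :: real)" for x
  proof -
    have p: "(\<Prod>m\<in>M. 1 - of_bool (linform d (c m i) x = 0)) = (of_bool (\<not> attacks M (piece x i) (piece x q)) :: real)" if "i < q" for i
    proof -
      have "(\<Prod>m\<in>M. 1 - of_bool (linform d (c m i) x = 0)) = (\<Prod>m\<in>M. of_bool (linform d (c m i) x \<noteq> 0) :: real)"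
        by (intro prod.cong) auto
      also have "\<dots> = of_bool (\<forall>m\<in>M. linform d (c m i) x \<noteq> 0)"
        using finM by (induction M rule: finite_induct) auto
      finally show ?thesis by (simp add: attacks_iff[OF M] c[OF that])
    qed
    have "(\<Prod>i<q. \<Prod>m\<in>M. 1 - of_bool (linform d (c m i) x = 0))
        = (\<Prod>i\<in>{..<q}. of_bool (\<not> attacks M (piece x i) (piece x q)) :: real)"
      by (intro prod.cong) (auto simp: p)
    also have "\<dots> = of_bool (\<forall>i\<in>{..<q}. \<not> attacks M (piece x i) (piece x q))"
      by (induction "{..<q}" rule: infinite_finite_induct) (auto simp: prod_eq_1_iff)
    finally show ?thesis by (auto simp: indep_append)
  qed
  ultimately show ?case by (simp only:)
qed

lemma quasi_poly_lsum_indep: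
  assumes "M \<subseteq> nightrider_moves"
  shows "quasi_poly (\<lambda>n. lsum (board n) q (\<lambda>zs. of_bool (indep (attacks M) zs)))"
proof -
  let ?G = "\<lambda>zs. of_bool (indep (attacks M) zs) :: real"
  have "(\<lambda>x. ?G (map (piece x) [0..<q])) \<in> pqp (1 + 2 * q)"
    by (rule pqp_indep_pieces[OF assms]) simp
  from pqp_itsum[OF this] obtain g where g: "g \<in> pqp 1"
    "\<And>x. 0 < x 0 \<Longrightarrow> itsum 1 (2 * q) (\<lambda>x. ?G (map (piece x) [0..<q])) x = g x"
    by auto
  have "g (\<lambda>_. int n + 1) = lsum (board n) q ?G" for n
    using g(2)[of "\<lambda>_. int n + 1"] itsum_eq_lsum[of "\<lambda>_. int n + 1" n 0 q ?G] by simp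
  then show ?thesis using pqp_one_quasi_poly[OF g(1)] by simp
qed

text \<open>Inverts \<open>lsum_indep\<close> by strong induction: the summand \<open>k = q\<close>
  is the wanted sum with factor 1, and all other summands are already quasipolynomial. Thus only the
  indicator of independence has to be written in coordinates.\<close>

lemma quasi_poly_lsum_mob:
  assumes "M \<subseteq> nightrider_moves"
  shows "quasi_poly (\<lambda>n. lsum (board n) q (mob (attacks M)))"
proof (induction q rule: less_induct)
  case (less q)
  have "quasi_poly (\<lambda>n. lsum (board n) q (\<lambda>zs. of_bool (indep (attacks M) zs)) -
     (\<Sum>k<q. poly (monom (real (q choose k)) (2 * (q - k))) (real n) * lsum (board n) k (mob (attacks M))))"
    using less by (intro quasi_poly_diff quasi_poly_lsum_indep[OF assms] quasi_poly_sum quasi_poly_mult quasi_poly_polynomial) auto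
  moreover have "lsum (board n) q (\<lambda>zs. of_bool (indep (attacks M) zs)) -
     (\<Sum>k<q. poly (monom (real (q choose k)) (2 * (q - k))) (real n) * lsum (board n) k (mob (attacks M)))
     = lsum (board n) q (mob (attacks M))" for n
    unfolding lsum_indep card_board
    by (simp add: lessThan_Suc_atMost[symmetric] poly_monom power_mult mult.assoc)
  ultimately show ?case by simp
qed

section \<open>Labelled placements as tuples\<close>

lemma lsum_eq_sum_lists:
  assumes "finite B"
  shows "lsum B q f = (\<Sum>zs\<in>{zs. set zs \<subseteq> B \<and> length zs = q}. f zs)"
proof (induction q arbitrary: f)
  case 0
  have "{zs. set zs \<subseteq> B \<and> zs = []} = {[]}" by auto
  then show ?case by simp
next
  case (Suc q)
  have "(\<Sum>zs\<in>{zs. set zs \<subseteq> B \<and> length zs = Suc q}. f zs) = (\<Sum>(zs, z)\<in>{zs. set zs \<subseteq> B \<and> length zs = q} \<times> B. f (z # zs))"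
    unfolding lists_length_Suc_eq by (subst sum.reindex) (auto simp: inj_on_def intro!: sum.cong)
  also have "\<dots> = (\<Sum>z\<in>B. \<Sum>zs\<in>{zs. set zs \<subseteq> B \<and> length zs = q}. f (z # zs))"
    by (subst sum.cartesian_product[symmetric]) (rule sum.swap)
  finally show ?case by (simp add: Suc.IH)
qed

lemma indep_iff:
  assumes "\<And>z. A z z" "\<And>u v. A u v \<Longrightarrow> A v u"
  shows "indep A zs \<longleftrightarrow> distinct zs \<and> (\<forall>u\<in>set zs. \<forall>v\<in>set zs. u \<noteq> v \<longrightarrow> \<not> A u v)"
  by (induction zs) (use assms in auto)

text \<open>Reflexivity of attacks forces the entries of an independent tuple to be distinct, so the
  tuples are the \<open>fact q\<close> orderings of each non-attacking set.\<close>

lemma o_count_eq_lsum: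
  assumes "M \<noteq> {}"
  shows "real (o_count M q n) = lsum (board n) q (\<lambda>zs. of_bool (indep (attacks M) zs))"
proof -
  let ?S = "{S. S \<subseteq> board n \<and> card S = q \<and> (\<forall>z\<in>S. \<forall>z'\<in>S. z \<noteq> z' \<longrightarrow> \<not> attacks M z z')}"
  have fin: "finite ?S" by (rule finite_subset[of _ "Pow (board n)"]) auto
  have finS: "finite S" if "S \<in> ?S" for S using that by (auto intro: finite_subset[OF _ finite_board])
  have ind: "indep (attacks M) zs \<longleftrightarrow> distinct zs \<and> (\<forall>u\<in>set zs. \<forall>v\<in>set zs. u \<noteq> v \<longrightarrow> \<not> attacks M u v)" for zs
    by (rule indep_iff) (auto intro: attacks_refl[OF assms] attacks_sym)
  have "{zs. set zs \<subseteq> board n \<and> length zs = q \<and> indep (attacks M) zs} = (\<Union>S\<in>?S. permutations_of_set S)"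
    unfolding ind
    by (auto simp: permutations_of_set_def distinct_card)
  then have "card {zs. set zs \<subseteq> board n \<and> length zs = q \<and> indep (attacks M) zs} = (\<Sum>S\<in>?S. card (permutations_of_set S))"
  proof (simp only:, intro card_UN_disjoint fin ballI impI)
    show "finite (permutations_of_set S)" for S :: "(int \<times> int) set"
      by (rule finite_permutations_of_set)
    show "permutations_of_set S \<inter> permutations_of_set S' = {}" if "S \<noteq> S'" for S S' :: "(int \<times> int) set"
      using that by (auto simp: permutations_of_set_def)
  qed
  also have "\<dots> = (\<Sum>S\<in>?S. fact q)"
    using finS by (intro sum.cong) auto
  also have "\<dots> = o_count M q n" by (simp add: o_count_def u_count_def)
  finally have card: "o_count M q n = card {zs. set zs \<subseteq> board n \<and> length zs = q \<and> indep (attacks M) zs}" ..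
  have "finite {zs. set zs \<subseteq> board n \<and> length zs = q}" by (rule finite_lists_length_eq) simp
  then show ?thesis
    unfolding card lsum_eq_sum_lists[OF finite_board]
    by (simp add: Int_def conj_assoc)
qed

section \<open>Attacking pairs of squares\<close>

definition aligned :: "int \<times> int \<Rightarrow> nat \<Rightarrow> ((int \<times> int) \<times> (int \<times> int)) set" where
  "aligned m n = {(z, v). z \<in> board n \<and> v \<in> board n \<and> fst m * (snd v - snd z) = snd m * (fst v - fst z)}"

lemma nightrider_moves_cases:
  assumes "m \<in> nightrider_moves"
  obtains "m = (1,2)" | "m = (2,1)" | "m = (1,-2)" | "m = (2,-1)"
  using assms unfolding nightrider_moves_def by blast

text \<open>No move is vertical, so a line in its direction meets each column at most once.\<close>

lemma card_nbrs_attacks: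
  assumes M: "M \<subseteq> nightrider_moves"
  shows "real (card (nbrs (attacks M) (board n) z)) \<le> real (card M) * real n"
proof -
  have finM: "finite M" using M by (rule finite_subset) (simp add: nightrider_moves_def)
  let ?L = "\<lambda>m. {v \<in> board n. fst m * (snd v - snd z) = snd m * (fst v - fst z)}"
  have "card (?L m) \<le> n" if "m \<in> M" for m
  proof -
    have "m \<in> nightrider_moves" using that M by auto
    then have "inj_on fst (?L m)" by (cases rule: nightrider_moves_cases) (auto simp: inj_on_def)
    then have "card (?L m) \<le> card {1..int n}"
      by (rule card_inj_on_le) (auto simp: board_def)
    then show ?thesis by simp
  qed
  then have "card (\<Union>m\<in>M. ?L m) \<le> (\<Sum>m\<in>M. n)"
    by (intro order_trans[OF card_UN_le[OF finM]] sum_mono)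
  moreover have "nbrs (attacks M) (board n) z = (\<Union>m\<in>M. ?L m)"
    by (auto simp: nbrs_def attacks_iff[OF M])
  ultimately have "card (nbrs (attacks M) (board n) z) \<le> card M * n" by simp
  then show ?thesis by (simp flip: of_nat_mult)
qed

lemma card_shifted_interval: "card {x\<in>{1..int n}. x + s \<in> {1..int n}} = nat (int n - \<bar>s\<bar>)"
proof -
  have "{x\<in>{1..int n}. x + s \<in> {1..int n}} = {max 1 (1 - s)..min (int n) (int n - s)}" by auto
  then show ?thesis by simp
qed

text \<open>For each multiple \<open>t\<close> the possible starting squares form the overlap of the
  board with its translate. The moves have coordinates 1 and 2 up to order and sign, so the overlap
  is the same for all four.\<close>

lemma card_aligned:
  assumes "m \<in> nightrider_moves"
  shows "card (aligned m n) = (\<Sum>t\<in>{- int n..int n}. nat (int n - \<bar>t\<bar>) * nat (int n - 2 * \<bar>t\<bar>))"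
proof -
  let ?X = "\<lambda>s. {x\<in>{1..int n}. x + s \<in> {1..int n}}"
  let ?T = "SIGMA t:{- int n..int n}. ?X (t * fst m) \<times> ?X (t * snd m)"
  let ?f = "\<lambda>(t, x, y). ((x, y), (x + t * fst m, y + t * snd m))"
  have inj: "inj_on ?f ?T"
    using assms by (cases rule: nightrider_moves_cases) (auto simp: inj_on_def)
  have "aligned m n = ?f ` ?T"
  proof (intro equalityI subsetI)
    fix w assume "w \<in> aligned m n"
    then obtain x y x' y' where w: "w = ((x, y), (x', y'))" "(x, y) \<in> board n" "(x', y') \<in> board n"
      and eq: "fst m * (y' - y) = snd m * (x' - x)"
      unfolding aligned_def by force
    obtain t where t: "x' - x = t * fst m" "y' - y = t * snd m"
    proof -
      have "attacks {m} (x, y) (x', y')" using assms eq by (subst attacks_iff) auto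
      then show ?thesis using that unfolding attacks_def by auto
    qed
    have "\<bar>t\<bar> \<le> int n"
      using assms t w(2,3) by (cases rule: nightrider_moves_cases) (auto simp: board_def)
    then have "(t, x, y) \<in> ?T" "w = ?f (t, x, y)"
      using t w by (auto simp: board_def algebra_simps)
    then show "w \<in> ?f ` ?T" by blast
  next
    fix w assume "w \<in> ?f ` ?T"
    then show "w \<in> aligned m n" by (auto simp: aligned_def board_def algebra_simps)
  qed
  then have "card (aligned m n) = card ?T" using card_image[OF inj] by simp
  also have "\<dots> = (\<Sum>t\<in>{- int n..int n}. nat (int n - \<bar>t * fst m\<bar>) * nat (int n - \<bar>t * snd m\<bar>))"
  proof -
    have "finite (?X s)" for s by (rule finite_subset[of _ "{1..int n}"]) auto
    then have "card ?T = (\<Sum>t\<in>{- int n..int n}. card (?X (t * fst m) \<times> ?X (t * snd m)))"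
      by (intro card_SigmaI finite_cartesian_product ballI) auto
    then show ?thesis by (simp only: card_cartesian_product card_shifted_interval)
  qed
  also have "\<dots> = (\<Sum>t\<in>{- int n..int n}. nat (int n - \<bar>t\<bar>) * nat (int n - 2 * \<bar>t\<bar>))"
    using assms by (cases rule: nightrider_moves_cases) (auto simp: abs_mult mult.commute)
  finally show ?thesis .
qed

lemma symmetric_quadratic_sum:
  fixes N :: real
  shows "(\<Sum>t\<in>{- int h..int h}. (N - \<bar>real_of_int t\<bar>) * (N - 2 * \<bar>real_of_int t\<bar>))
    = N\<^sup>2 + 2 * (real h * N\<^sup>2 - 3 / 2 * N * real h * (real h + 1) + real h * (real h + 1) * (2 * real h + 1) / 3)"
proof (induction h)
  case 0
  then show ?case by (simp add: power2_eq_square)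
next
  case (Suc h)
  have "{- int (Suc h)..int (Suc h)} = insert (- int (Suc h)) (insert (int (Suc h)) {- int h..int h})" by auto
  then show ?case using Suc.IH by (simp add: field_simps power2_eq_square)
qed

lemma card_aligned_closed_form:
  assumes "m \<in> nightrider_moves"
  defines "h \<equiv> \<lambda>n. real (n div 2)"
  shows "real (card (aligned m n)) = (real n)\<^sup>2 + 2 * (h n * (real n)\<^sup>2 - 3 / 2 * real n * h n * (h n + 1)
    + h n * (h n + 1) * (2 * h n + 1) / 3)"
proof -
  have "real (card (aligned m n)) = (\<Sum>t\<in>{- int n..int n}. real (nat (int n - \<bar>t\<bar>)) * real (nat (int n - 2 * \<bar>t\<bar>)))"
    unfolding card_aligned[OF assms(1)] by simp
  \<comment> \<open>Truncation by \<open>nat\<close> kills the terms with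
    \<open>2 * \<bar>t\<bar> > n\<close>; on the remaining range both factors are genuine
    differences and the sum is polynomial in \<open>n\<close> and \<open>n div 2\<close>.\<close>
  also have "\<dots> = (\<Sum>t\<in>{- int (n div 2)..int (n div 2)}. (real n - \<bar>real_of_int t\<bar>) * (real n - 2 * \<bar>real_of_int t\<bar>))"
  proof (rule sum.mono_neutral_cong_right)
    show "\<forall>t\<in>{- int n..int n} - {- int (n div 2)..int (n div 2)}. real (nat (int n - \<bar>t\<bar>)) * real (nat (int n - 2 * \<bar>t\<bar>)) = 0"
    proof
      fix t assume "t \<in> {- int n..int n} - {- int (n div 2)..int (n div 2)}"
      then have "int n - 2 * \<bar>t\<bar> \<le> 0" by auto
      then show "real (nat (int n - \<bar>t\<bar>)) * real (nat (int n - 2 * \<bar>t\<bar>)) = 0" by simp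
    qed
  next
    fix t assume "t \<in> {- int (n div 2)..int (n div 2)}"
    then have "0 \<le> int n - 2 * \<bar>t\<bar>" by auto
    then show "real (nat (int n - \<bar>t\<bar>)) * real (nat (int n - 2 * \<bar>t\<bar>)) = (real n - \<bar>real_of_int t\<bar>) * (real n - 2 * \<bar>real_of_int t\<bar>)"
      by (simp add: of_nat_nat)
  qed auto
  finally show ?thesis unfolding h_def symmetric_quadratic_sum .
qed

text \<open>The constant is the integral of (1 - |t|)(1 - 2|t|) over |t| \<le> 1/2, twice 1/2 - 3/8
  + 1/12.\<close>

lemma card_aligned_tendsto:
  assumes "m \<in> nightrider_moves"
  shows "(\<lambda>n. real (card (aligned m n)) / real n ^ 3) \<longlonglongrightarrow> 5 / 12"
proof -
  let ?u = "\<lambda>n. real (n div 2) / real n" and ?i = "\<lambda>n. inverse (real n)"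
  have i: "?i \<longlonglongrightarrow> 0" by (rule lim_inverse_n)
  have "(\<lambda>n. ?u n - 1 / 2) \<longlonglongrightarrow> 0"
  proof (rule tendsto_0_le[OF i])
    have "norm (?u n - 1 / 2) \<le> norm (?i n) * 1" if "1 \<le> n" for n
    proof -
      have "2 * (n div 2) \<le> n" "n \<le> 2 * (n div 2) + 1" by auto
      then have "\<bar>2 * real (n div 2) - real n\<bar> \<le> 1" by linarith
      moreover have "?u n - 1 / 2 = (2 * real (n div 2) - real n) * (?i n / 2)" using that by (simp add: field_simps)
      ultimately have "\<bar>?u n - 1 / 2\<bar> \<le> 1 * (?i n / 2)"
        by (simp only: abs_mult) (intro mult_mono, auto)
      also have "\<dots> \<le> ?i n" by simp
      finally show ?thesis by simp
    qed
    then show "eventually (\<lambda>n. norm (?u n - 1 / 2) \<le> norm (?i n) * 1) sequentially"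
      by (intro eventually_mono[OF eventually_ge_at_top[of 1]])
  qed
  then have u: "?u \<longlonglongrightarrow> 1 / 2" by (simp add: LIM_zero_iff)
  have "(\<lambda>n. ?i n + 2 * (?u n - 3 / 2 * ?u n * (?u n + ?i n) + ?u n * (?u n + ?i n) * (2 * ?u n + ?i n) / 3))
     \<longlonglongrightarrow> 0 + 2 * (1 / 2 - 3 / 2 * (1 / 2) * (1 / 2 + 0) + 1 / 2 * (1 / 2 + 0) * (2 * (1 / 2) + 0) / 3)"
    by (intro tendsto_intros u i) simp
  moreover have "eventually (\<lambda>n. ?i n + 2 * (?u n - 3 / 2 * ?u n * (?u n + ?i n) + ?u n * (?u n + ?i n) * (2 * ?u n + ?i n) / 3)
      = real (card (aligned m n)) / real n ^ 3) sequentially"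
    using eventually_ge_at_top[of 1]
    by eventually_elim (simp add: card_aligned_closed_form[OF assms] field_simps power2_eq_square power3_eq_cube)
  ultimately show ?thesis by (simp add: tendsto_cong)
qed

text \<open>Moves are pairwise non-parallel, so two of the sets \<open>aligned m n\<close> share
  only the diagonal. Once the diagonal is counted separately, the union is disjoint.\<close>

lemma sum_card_nbrs_attacks:
  assumes M: "M \<subseteq> nightrider_moves" and "M \<noteq> {}"
  shows "(\<Sum>z\<in>board n. real (card (nbrs (attacks M) (board n) z)))
    = real n ^ 2 + (\<Sum>m\<in>M. real (card (aligned m n)) - real n ^ 2)"
proof -
  have finM: "finite M" using M by (rule finite_subset) (simp add: nightrider_moves_def)
  let ?D = "Id_on (board n)"
  have "?D = (\<lambda>z. (z, z)) ` board n" by (auto simp: Id_on_def)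
  then have D: "card ?D = n ^ 2" "finite ?D"
    by (simp_all add: card_image inj_on_def card_board)
  have fin: "finite (aligned m n)" for m
    by (rule finite_subset[of _ "board n \<times> board n"]) (auto simp: aligned_def)
  have sub: "?D \<subseteq> aligned m n" for m by (auto simp: aligned_def)
  have "(\<Sum>z\<in>board n. card (nbrs (attacks M) (board n) z)) = card (SIGMA z:board n. nbrs (attacks M) (board n) z)"
    by (subst card_SigmaI) (auto simp: nbrs_def)
  also have "(SIGMA z:board n. nbrs (attacks M) (board n) z) = ?D \<union> (\<Union>m\<in>M. aligned m n - ?D)"
    using attacks_refl[OF assms(2)] by (auto simp: nbrs_def attacks_iff[OF M] aligned_def)
  also have "card \<dots> = card ?D + card (\<Union>m\<in>M. aligned m n - ?D)"
    using D finM fin by (intro card_Un_disjoint) auto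
  also have "card (\<Union>m\<in>M. aligned m n - ?D) = (\<Sum>m\<in>M. card (aligned m n - ?D))"
  proof (rule card_UN_disjoint[OF finM])
    show "\<forall>m\<in>M. finite (aligned m n - ?D)" using fin by simp
    show "\<forall>m\<in>M. \<forall>m'\<in>M. m \<noteq> m' \<longrightarrow> (aligned m n - ?D) \<inter> (aligned m' n - ?D) = {}"
    proof (intro ballI impI)
      fix m m' assume "m \<in> M" "m' \<in> M" and ne: "m \<noteq> m'"
      then have mm: "m \<in> nightrider_moves" "m' \<in> nightrider_moves" using M by auto
      have "z = v" if "(z, v) \<in> aligned m n" "(z, v) \<in> aligned m' n" for z v
        using that ne mm(2) mm(1)[THEN nightrider_moves_cases]
        by (cases z; cases v; cases rule: nightrider_moves_cases[OF mm(1)]; cases rule: nightrider_moves_cases[OF mm(2)])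
           (simp_all add: aligned_def)
      then show "(aligned m n - ?D) \<inter> (aligned m' n - ?D) = {}"
        by (auto simp: aligned_def)
    qed
  qed
  finally have "(\<Sum>z\<in>board n. card (nbrs (attacks M) (board n) z)) = n ^ 2 + (\<Sum>m\<in>M. card (aligned m n) - n ^ 2)"
    using D sub by (simp add: card_Diff_subset)
  then have "real (\<Sum>z\<in>board n. card (nbrs (attacks M) (board n) z)) = real n ^ 2 + (\<Sum>m\<in>M. real (card (aligned m n) - n ^ 2))"
    by simp
  moreover have "n ^ 2 \<le> card (aligned m n)" for m
    using card_mono[OF fin sub[of m]] D by simp
  ultimately show ?thesis by (simp add: of_nat_diff)
qed

lemma sum_card_nbrs_tendsto:
  assumes M: "M \<subseteq> nightrider_moves" and "M \<noteq> {}"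
  shows "(\<lambda>n. (\<Sum>z\<in>board n. real (card (nbrs (attacks M) (board n) z))) / real n ^ 3) \<longlonglongrightarrow> 5 * real (card M) / 12"
proof -
  have "(\<lambda>n. real n ^ 2 / real n ^ 3) \<longlonglongrightarrow> 0"
    by (rule bigo_power_tendsto_0[of _ 2]) simp_all
  then have "(\<lambda>n. real n ^ 2 / real n ^ 3 + (\<Sum>m\<in>M. real (card (aligned m n)) / real n ^ 3 - real n ^ 2 / real n ^ 3))
     \<longlonglongrightarrow> 0 + (\<Sum>m\<in>M. 5 / 12 - 0)"
    using M by (intro tendsto_add tendsto_sum tendsto_diff card_aligned_tendsto) auto
  then show ?thesis
    unfolding sum_card_nbrs_attacks[OF assms] by (simp add: add_divide_distrib sum_divide_distrib diff_divide_distrib mult.commute)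
qed

section \<open>The coefficients\<close>

lemma periodic_nat_mod: "0 < p \<Longrightarrow> periodic_nat (\<lambda>n. g (n mod p))"
  unfolding periodic_nat_def by (intro exI[of _ p]) simp

lemma periodic_nat_scale: "periodic_nat f \<Longrightarrow> periodic_nat (\<lambda>n. c * f n)"
  unfolding periodic_nat_def by auto

lemma periodic_nat_iterate:
  fixes f :: "nat \<Rightarrow> 'a"
  assumes "\<And>n. f (n + p) = f n"
  shows "f (n + p * j) = f n"
proof (induction j)
  case (Suc j)
  have "f (n + p * Suc j) = f ((n + p * j) + p)" by (simp add: algebra_simps)
  also have "\<dots> = f n" using Suc.IH assms by simp
  finally show ?case .
qed simp

lemma periodic_nat_add:
  assumes "periodic_nat f" "periodic_nat g"
  shows "periodic_nat (\<lambda>n. f n + g n)"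
proof -
  obtain p q where p: "0 < p" "\<And>n. f (n + p) = f n" and q: "0 < q" "\<And>n. g (n + q) = g n"
    using assms unfolding periodic_nat_def by blast
  have "f (n + p * q) + g (n + p * q) = f n + g n" for n
    using periodic_nat_iterate[of f p n q, OF p(2)] periodic_nat_iterate[of g q n p, OF q(2)] by (simp add: mult.commute)
  then show ?thesis unfolding periodic_nat_def using p q by (intro exI[of _ "p * q"]) simp
qed

lemma periodic_nat_sum: "(\<And>k. k \<in> K \<Longrightarrow> periodic_nat (f k)) \<Longrightarrow> periodic_nat (\<lambda>n. \<Sum>k\<in>K. f k n)"
proof (induction K rule: infinite_finite_induct)
  case (insert k K)
  then show ?case by (simp add: periodic_nat_add)
qed (auto simp: periodic_nat_def)

section \<open>Binomial coefficients as polynomials in the number of pieces\<close>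

definition binomial_poly :: "nat \<Rightarrow> real poly" where
  "binomial_poly k = smult (1 / fact k) (\<Prod>i<k. [:- real i, 1:])"

lemma poly_binomial_poly: "poly (binomial_poly k) (real q) = real (q choose k)"
  by (simp add: binomial_poly_def poly_prod binomial_gbinomial gbinomial_prod_rev atLeast0LessThan)

lemma degree_prod_linear: "degree (\<Prod>i<k. [:- real i, 1:]) = k"
  by (subst degree_prod_eq_sum_degree) auto

lemma degree_binomial_poly: "degree (binomial_poly k) = k"
  by (simp add: binomial_poly_def degree_prod_linear)

lemma lead_coeff_binomial_poly: "coeff (binomial_poly k) k = 1 / fact k"
proof -
  have "lead_coeff (\<Prod>i<k. [:- real i, 1:]) = 1" by (simp add: lead_coeff_prod)
  then show ?thesis by (simp add: binomial_poly_def degree_prod_linear)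
qed

text \<open>The identity (2i-1)!! / (2i)! = 1 / (2^i i!), with a factor \<open>- \<alpha>\<close>
  attached to each odd number.\<close>

lemma prod_odd_fact: "(\<Prod>l<i. - (2 * real l + 1) * \<alpha>) / fact (2 * i) = (- \<alpha> / 2) ^ i / fact i"
proof (induction i)
  case (Suc i)
  have "(\<Prod>l<Suc i. - (2 * real l + 1) * \<alpha>) / fact (2 * Suc i)
    = (\<Prod>l<i. - (2 * real l + 1) * \<alpha>) / fact (2 * i) * (- (2 * real i + 1) * \<alpha> / ((2 * real i + 1) * (2 * real i + 2)))"
    by (simp add: algebra_simps)
  also have "- (2 * real i + 1) * \<alpha> / ((2 * real i + 1) * (2 * real i + 2)) = - \<alpha> / 2 / (real i + 1)"
  proof -
    have cancel: "- x * \<alpha> / (x * y) = - \<alpha> / y" if "x \<noteq> 0" for x y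
      using that by simp
    have "2 * real i + 1 \<noteq> 0" by (simp add: add_nonneg_eq_0_iff)
    then show ?thesis unfolding cancel[OF \<open>2 * real i + 1 \<noteq> 0\<close>] by (simp add: distrib_left)
  qed
  also have "(\<Prod>l<i. - (2 * real l + 1) * \<alpha>) / fact (2 * i) * (- \<alpha> / 2 / (real i + 1)) = (- \<alpha> / 2) ^ Suc i / fact (Suc i)"
    unfolding Suc.IH by (simp add: algebra_simps)
  finally show ?case .
qed simp

theorem theorem9p1:
  fixes M :: "(int \<times> int) set" and k :: nat
  assumes "M \<subseteq> nightrider_moves" and "card M = k" and "1 \<le> k"
  shows "\<exists>\<gamma> :: nat \<Rightarrow> nat \<Rightarrow> nat \<Rightarrow> real.
     (\<forall>q i. periodic_nat (\<gamma> q i)) \<and>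
     (\<forall>q n. 1 \<le> n \<longrightarrow>
        real (u_count M q n) = (\<Sum>i\<le>2*q. \<gamma> q i n * real n ^ (2*q - i))) \<and>
     (\<forall>i. \<exists>c :: nat \<Rightarrow> nat \<Rightarrow> real.
        (\<forall>j. periodic_nat (c j)) \<and>
        (\<forall>n. c (2*i) n = (- 5 * real k / 24) ^ i / fact i) \<and>
        (\<forall>q n. i \<le> 2*q \<longrightarrow>
           real (o_count M q n) = (\<Sum>i'\<le>2*q. fact q * \<gamma> q i' n * real n ^ (2*q - i')) \<and>
           fact q * \<gamma> q i n = (\<Sum>j\<le>2*i. c j n * real q ^ j)))"
proof -
  note M = assms(1)
  have ne: "M \<noteq> {}" using assms(2,3) by auto
  let ?A = "attacks M"
  define w where "w l n = lsum (board n) l (mob ?A)" for l n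
  have "\<exists>p P. 0 < p \<and> (\<forall>n. w l n = poly (P (n mod p)) (real n))" for l
    using quasi_poly_lsum_mob[OF M, of l] unfolding quasi_poly_def w_def by blast
  then obtain p :: "nat \<Rightarrow> nat" and P :: "nat \<Rightarrow> nat \<Rightarrow> real poly"
    where p: "\<And>l. 0 < p l" and P: "\<And>l n. w l n = poly (P l (n mod p l)) (real n)"
    by metis
  note board_facts = attacks_sym finite_board card_board card_nbrs_attacks[OF M]
  have "w l \<in> O(\<lambda>n. real n ^ (l + l div 2))" for l
  proof -
    have "w l = (\<lambda>n. lsum (board n) l (mob ?A))" by (simp add: w_def fun_eq_iff)
    then show ?thesis using mob_sum_bigo[of ?A board, OF board_facts] by simp
  qed
  then have deg: "degree (P l (n mod p l)) \<le> l + l div 2" for l n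
    using p by (intro quasi_poly_degree_le[of "w l", OF P]) auto
  have lead: "coeff (P (2 * i) (n mod p (2 * i))) (3 * i) = (\<Prod>l<i. - (2 * real l + 1) * (5 * real k / 12))" for i n
  proof (rule quasi_poly_subseq_tendsto[of "w (2 * i)", OF P])
    show "(\<lambda>n. w (2 * i) n / real n ^ (3 * i)) \<longlonglongrightarrow> (\<Prod>l<i. - (2 * real l + 1) * (5 * real k / 12))"
      using mob_sum_even_tendsto[of ?A board, OF board_facts sum_card_nbrs_tendsto[OF M ne]]
      unfolding w_def assms(2) .
    show "degree (P (2 * i) (n mod p (2 * i))) \<le> 3 * i" using deg[of "2 * i" n] by simp
  qed (simp add: p)
  \<comment> \<open>Indexed by the codimension \<open>i\<close>, so that multiplication by
    \<open>n ^ (2 * (q - l))\<close> leaves the index alone whatever \<open>q\<close> is. The guard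
    matters: for \<open>i > 2 * l\<close> truncated subtraction would return the constant
    coefficient.\<close>
  define a where "a l i n = (if i \<le> 2 * l then coeff (P l (n mod p l)) (2 * l - i) else 0)" for l i n
  have a_periodic: "periodic_nat (a l i)" for l i
    unfolding a_def using periodic_nat_mod[OF p, of "\<lambda>r. if i \<le> 2 * l then coeff (P l r) (2 * l - i) else 0" l] by simp
  define \<gamma> where "\<gamma> q i n = 1 / fact q * (\<Sum>l\<le>q. real (q choose l) * a l i n)" for q i n
  have \<gamma>: "fact q * \<gamma> q i n = (\<Sum>l\<le>q. real (q choose l) * a l i n)" for q i n
    unfolding \<gamma>_def by simp
  have w_a: "real n ^ (2 * (q - l)) * w l n = (\<Sum>i\<le>2*q. a l i n * real n ^ (2*q - i))" if "l \<le> q" for q l n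
  proof -
    have "w l n = (\<Sum>j\<le>2*l. coeff (P l (n mod p l)) j * real n ^ j)"
      unfolding P using deg[of l n] by (intro poly_eq_sum_coeff) linarith
    also have "\<dots> = (\<Sum>i\<le>2*l. coeff (P l (n mod p l)) (2 * l - i) * real n ^ (2 * l - i))"
      by (rule sum.reindex_bij_witness[of _ "\<lambda>i. 2 * l - i" "\<lambda>i. 2 * l - i"]) auto
    finally have "real n ^ (2 * (q - l)) * w l n = (\<Sum>i\<le>2*l. a l i n * (real n ^ (2 * (q - l)) * real n ^ (2 * l - i)))"
      by (simp add: a_def sum_distrib_left mult_ac)
    also have "\<dots> = (\<Sum>i\<le>2*l. a l i n * real n ^ (2*q - i))"
    proof (rule sum.cong[OF refl])
      fix i assume "i \<in> {..2*l}"
      then have "2 * (q - l) + (2 * l - i) = 2 * q - i" using that by auto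
      then show "a l i n * (real n ^ (2 * (q - l)) * real n ^ (2 * l - i)) = a l i n * real n ^ (2*q - i)"
        by (simp flip: power_add)
    qed
    also have "\<dots> = (\<Sum>i\<le>2*q. a l i n * real n ^ (2*q - i))"
      using that by (intro sum.mono_neutral_left) (auto simp: a_def)
    finally show ?thesis .
  qed
  have o: "real (o_count M q n) = (\<Sum>i\<le>2*q. fact q * \<gamma> q i n * real n ^ (2*q - i))" for q n
  proof -
    have "real (o_count M q n) = (\<Sum>l\<le>q. real (q choose l) * (real n ^ (2 * (q - l)) * w l n))"
      unfolding o_count_eq_lsum[OF ne] lsum_indep card_board w_def by (simp add: power_mult)
    also have "\<dots> = (\<Sum>l\<le>q. \<Sum>i\<le>2*q. real (q choose l) * (a l i n * real n ^ (2*q - i)))"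
      by (intro sum.cong refl) (simp add: w_a sum_distrib_left)
    also have "\<dots> = (\<Sum>i\<le>2*q. fact q * \<gamma> q i n * real n ^ (2*q - i))"
      unfolding \<gamma> by (subst sum.swap) (simp add: sum_distrib_right mult.assoc)
    finally show ?thesis .
  qed
  have u: "real (u_count M q n) = (\<Sum>i\<le>2*q. \<gamma> q i n * real n ^ (2*q - i))" for q n
  proof -
    have "fact q * real (u_count M q n) = fact q * (\<Sum>i\<le>2*q. \<gamma> q i n * real n ^ (2*q - i))"
      using o[of q n] by (simp add: o_count_def sum_distrib_left mult.assoc)
    then show ?thesis by simp
  qed
  have c: "\<exists>c :: nat \<Rightarrow> nat \<Rightarrow> real. (\<forall>j. periodic_nat (c j)) \<and> (\<forall>n. c (2*i) n = (- 5 * real k / 24) ^ i / fact i) \<and>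
        (\<forall>q n. fact q * \<gamma> q i n = (\<Sum>j\<le>2*i. c j n * real q ^ j))" for i
  proof -
    \<comment> \<open>For \<open>l > 2 * i\<close> the degree bound \<open>l + l div 2\<close> is
      already below \<open>2 * l - i\<close>; this cutoff does not involve \<open>q\<close>.\<close>
    have a0: "a l i n = 0" if "2 * i < l" for l n
    proof -
      have "l + l div 2 < 2 * l - i" using that by linarith
      then show ?thesis unfolding a_def using deg[of l n] by (auto intro!: coeff_eq_0)
    qed
    define c where "c j n = (\<Sum>l\<le>2*i. coeff (binomial_poly l) j * a l i n)" for j n
    have "periodic_nat (c j)" for j
      unfolding c_def by (intro periodic_nat_sum periodic_nat_scale a_periodic)
    moreover have "c (2*i) n = (- 5 * real k / 24) ^ i / fact i" for n
    proof -
      \<comment> \<open>Among the \<open>binomial_poly l\<close> with \<open>l \<le> 2 * i\<close>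
        only the last reaches degree \<open>2 * i\<close>, so one Moebius sum determines the top
        coefficient.\<close>
      have "c (2*i) n = (\<Sum>l\<in>{2*i}. coeff (binomial_poly l) (2*i) * a l i n)"
        unfolding c_def by (rule sum.mono_neutral_right) (auto simp: coeff_eq_0 degree_binomial_poly)
      also have "\<dots> = (\<Prod>l<i. - (2 * real l + 1) * (5 * real k / 12)) / fact (2 * i)"
        using lead[of i n] by (simp add: lead_coeff_binomial_poly a_def)
      also have "\<dots> = (- 5 * real k / 24) ^ i / fact i"
        unfolding prod_odd_fact by simp
      finally show ?thesis .
    qed
    moreover have "fact q * \<gamma> q i n = (\<Sum>j\<le>2*i. c j n * real q ^ j)" for q n
    proof -
      \<comment> \<open>Passing through the larger range exchanges the bound \<open>q\<close> for
        \<open>2 * i\<close>: beyond \<open>q\<close> the binomial vanishes, beyond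
        \<open>2 * i\<close> the factor \<open>a l i n\<close> does.\<close>
      have "fact q * \<gamma> q i n = (\<Sum>l\<le>max q (2*i). real (q choose l) * a l i n)"
        unfolding \<gamma> by (rule sum.mono_neutral_left) auto
      also have "\<dots> = (\<Sum>l\<le>2*i. real (q choose l) * a l i n)"
        by (rule sum.mono_neutral_right) (auto simp: a0)
      also have "\<dots> = (\<Sum>l\<le>2*i. \<Sum>j\<le>2*i. coeff (binomial_poly l) j * real q ^ j * a l i n)"
      proof (rule sum.cong[OF refl])
        fix l assume "l \<in> {..2*i}"
        then have "real (q choose l) = (\<Sum>j\<le>2*i. coeff (binomial_poly l) j * real q ^ j)"
          unfolding poly_binomial_poly[symmetric] by (intro poly_eq_sum_coeff) (simp add: degree_binomial_poly)
        then show "real (q choose l) * a l i n = (\<Sum>j\<le>2*i. coeff (binomial_poly l) j * real q ^ j * a l i n)"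
          by (simp only: sum_distrib_right)
      qed
      also have "\<dots> = (\<Sum>j\<le>2*i. c j n * real q ^ j)"
        unfolding c_def by (subst sum.swap) (simp add: sum_distrib_left sum_distrib_right mult_ac)
      finally show ?thesis .
    qed
    ultimately show ?thesis by blast
  qed
  have per: "periodic_nat (\<gamma> q i)" for q i
    unfolding \<gamma>_def by (intro periodic_nat_scale periodic_nat_sum a_periodic)
  show ?thesis
  proof (rule exI[of _ \<gamma>], intro conjI allI impI)
    fix i
    obtain c where "\<forall>j. periodic_nat (c j)" "\<forall>n. c (2*i) n = (- 5 * real k / 24) ^ i / fact i"
      "\<forall>q n. fact q * \<gamma> q i n = (\<Sum>j\<le>2*i. c j n * real q ^ j)"
      using c[of i] by blast
    with o show "\<exists>c. (\<forall>j. periodic_nat (c j)) \<and> (\<forall>n. c (2*i) n = (- 5 * real k / 24) ^ i / fact i) \<and>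
        (\<forall>q n. i \<le> 2*q \<longrightarrow>
           real (o_count M q n) = (\<Sum>i'\<le>2*q. fact q * \<gamma> q i' n * real n ^ (2*q - i')) \<and>
           fact q * \<gamma> q i n = (\<Sum>j\<le>2*i. c j n * real q ^ j))"
      by (intro exI[of _ c] conjI allI impI) simp_all
  qed (rule per, rule u)
qed

end
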